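(* For all real $Q \ge 1$ and $x \ge 1$, $$ \sum_{q \leq Q} \left| \sum_{p \leq x} \varphi_q(\sigma_p) \right|^2 \ \leq\ Q \sum_{q \leq Q}\ \sum_{c \in \mathbb{F}_{q}^{*}} \left| \sum_{\substack{p \leq x \\ p \equiv 1 \,(\mathrm{mod}\, q)}} e\left(\frac{i_p c}{q}\right) \right|^2. $$
   Context: Notation: $e(t) = e^{2\pi i t}$. The sum $\sum_{q\le Q}$ runs over odd primes $q \le Q$; $\mathbb{F}_q^{*}$ is identified with the residues $\{1,\dots,q-1\}$ modulo $q$. The sum over $p\le x$ is over odd primes $p$. For an odd prime $p$, $i_p = [\mathbb{F}_p^* : \langle 2\rangle]$ denotes the index of the subgroup generated by $2$ modulo $p$. For an odd prime $q$, $L_q = \mathbb{Q}(e^{2\pi i/q}, 2^{1/q})$ and $\mathrm{G}_q = \mathrm{Gal}(L_q/\mathbb{Q})$. The group $\mathrm{G}_q$ is isomorphic to the group of matrices $\begin{bmatrix} a & b\\ 0 & 1\end{bmatrix}$ with $a\in\mathbb{F}_q^*$, $b\in\mathbb{F}_q$, where such a matrix corresponds to $\zeta_q\mapsto\zeta_q^a$, $2^{1/q}\mapsto \zeta_q^b 2^{1/q}$ ($\zeta_q=e^{2\pi i/q}$). It has exactly $q$ irreducible complex characters, $q-1$ of which are one-dimensional; $\varphi_q$ denotes the remaining one, which has dimension $q-1$. Its values are $q-1$ at the identity, $-1$ at matrices with $a=1$, $b\neq 0$, and $0$ at matrices with $a\ne 1$. For an odd prime $p\ne q$, $\sigma_p$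 denotes a Frobenius element of $p$ in $\mathrm{G}_q$ (well defined up to conjugacy, so $\varphi_q(\sigma_p)$ is well defined). For $p=q$ one sets $\varphi_q(\sigma_p)=0$. *)

theory Defs
  imports
    Complex_Main
    "HOL-Algebra.Algebra"
    "HOL-Number_Theory.Number_Theory"
    "Jordan_Normal_Form.VS_Connect"
begin

definition e2pi :: "real \<Rightarrow> complex" where
  "e2pi t = exp (2 * of_real pi * \<i> * of_real t)"

definition odd_primes_upto :: "real \<Rightarrow> nat set" where
  "odd_primes_upto y = {p. Factorial_Ring.prime p \<and> odd p \<and> real p \<le> y}"

definition index_of_two :: "nat \<Rightarrow> nat" where
  "index_of_two p =
     (let G = units_of (residue_ring (int p)) in card (rcosets\<^bsub>G\<^esub> (generate G {2})))"


subsection \<open>Galois groups and Frobenius elements\<close>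

text \<open>Fields are taken inside the complex numbers.\<close>

definition ring_on :: "complex set \<Rightarrow> complex ring" where
  "ring_on S = class_ring\<lparr>carrier := S\<rparr>"

definition int_ring_of :: "complex set \<Rightarrow> complex set" where
  "int_ring_of L = {x \<in> L. algebraic_int x}"

text \<open>
  Automorphisms are extensional functions (undefined outside \<open>L\<close>), as in \<^const>\<open>BijGroup\<close>,
  so that each automorphism of \<open>L\<close> is represented exactly once.
\<close>

definition Gal :: "complex set \<Rightarrow> complex set \<Rightarrow> (complex \<Rightarrow> complex) monoid" where
  "Gal L K = (BijGroup L)
     \<lparr>carrier := {\<sigma> \<in> Bij L. \<sigma> \<in> ring_iso (ring_on L) (ring_on L) \<and> (\<forall>x\<in>K. \<sigma> x = x)}\<rparr>"

text \<open>
  A Frobenius element of \<open>p\<close> in the Galois group of \<open>L\<close> over the rationals, for \<open>L\<close> a finite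
  Galois extension of the rationals in which \<open>p\<close> is unramified: it belongs to some prime
  \<open>P\<close> of the ring of integers lying above \<open>p\<close>.
\<close>

definition frobenius_element :: "complex set \<Rightarrow> nat \<Rightarrow> (complex \<Rightarrow> complex) \<Rightarrow> bool" where
  "frobenius_element L p \<sigma> \<longleftrightarrow>
     \<sigma> \<in> carrier (Gal L \<rat>) \<and>
     (\<exists>P. primeideal P (ring_on (int_ring_of L)) \<and> of_nat p \<in> P \<and>
          (\<forall>x\<in>int_ring_of L. \<sigma> x - x ^ p \<in> P))"


subsection \<open>Complex representations and characters\<close>

definition mat_trace :: "complex mat \<Rightarrow> complex" where
  "mat_trace A = (\<Sum>i<dim_row A. A $$ (i, i))"

definition representation :: "('g, 'b) monoid_scheme \<Rightarrow> nat \<Rightarrow> ('g \<Rightarrow> complex mat) \<Rightarrow> bool" where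
  "representation G n \<rho> \<longleftrightarrow> \<rho> \<in> hom G (units_of (ring_mat TYPE(complex) n ()))"

definition irreducible_representation ::
    "('g, 'b) monoid_scheme \<Rightarrow> nat \<Rightarrow> ('g \<Rightarrow> complex mat) \<Rightarrow> bool" where
  "irreducible_representation G n \<rho> \<longleftrightarrow>
     representation G n \<rho> \<and> n > 0 \<and>
     (\<forall>W. subspace class_ring W (module_vec TYPE(complex) n) \<longrightarrow>
          (\<forall>g\<in>carrier G. \<forall>w\<in>W. \<rho> g *\<^sub>v w \<in> W) \<longrightarrow>
          W = {0\<^sub>v n} \<or> W = carrier_vec n)"

definition irreducible_character :: "('g, 'b) monoid_scheme \<Rightarrow> ('g \<Rightarrow> complex) \<Rightarrow> bool" where
  "irreducible_character G \<chi> \<longleftrightarrow>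
     (\<exists>n \<rho>. irreducible_representation G n \<rho> \<and> \<chi> = (\<lambda>g\<in>carrier G. mat_trace (\<rho> g)))"


subsection \<open>The field $L_q$, its Galois group and the character $\varphi_q$\<close>

definition Lfield :: "nat \<Rightarrow> complex set" where
  "Lfield q = generate_field class_ring (\<rat> \<union> {e2pi (1 / real q), of_real (root q 2)})"

definition Ggroup :: "nat \<Rightarrow> (complex \<Rightarrow> complex) monoid" where
  "Ggroup q = Gal (Lfield q) \<rat>"

text \<open>
  For an odd prime \<open>q\<close>, all but one of the irreducible characters of \<open>Ggroup q\<close> are
  one-dimensional; the value of a character at the identity is its dimension.
\<close>

definition phi :: "nat \<Rightarrow> (complex \<Rightarrow> complex) \<Rightarrow> complex" where
  "phi q = (THE \<chi>. irreducible_character (Ggroup q) \<chi> \<and> \<chi> \<one>\<^bsub>Ggroup q\<^esub> \<noteq> 1)"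

text \<open>
  \<open>\<sigma> q p\<close> is the chosen Frobenius element of \<open>p\<close> in \<open>Ggroup q\<close>; the value at \<open>p = q\<close> is zero by
  convention.
\<close>

definition phi_frob :: "(nat \<Rightarrow> nat \<Rightarrow> complex \<Rightarrow> complex) \<Rightarrow> nat \<Rightarrow> nat \<Rightarrow> complex" where
  "phi_frob \<sigma> q p = (if p = q then 0 else phi q (\<sigma> q p))"

end

theory Submission
  imports Defs "Berlekamp_Zassenhaus.Factor_Bound" "Jordan_Normal_Form.Spectral_Radius"
    "HOL-Analysis.Convex"
begin

text \<open>
  Every Frobenius element \<open>\<sigma>\<close> of \<open>p\<close> acts by \<open>\<zeta> \<mapsto> \<zeta>\<^sup>p\<close>, so \<open>\<phi>\<^sub>q(\<sigma>) = 0\<close> unless \<open>p \<equiv> 1\<close> modulo \<open>q\<close>. In that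
  case \<open>\<sigma>\<close> multiplies the \<open>q\<close>-th root of 2 by a root of unity congruent to \<open>2\<close> to the power
  \<open>(p - 1) / q\<close> modulo a prime above \<open>p\<close>; hence \<open>\<sigma>\<close> is trivial iff \<open>q\<close> divides \<open>i\<^sub>p\<close>, and \<open>\<phi>\<^sub>q(\<sigma>)\<close> is \<open>q - 1\<close>
  or \<open>-1\<close> accordingly, which is the sum of \<open>e(i\<^sub>p c / q)\<close> over \<open>c\<close>. The inequality is then Cauchy--Schwarz
  over the \<open>q - 1\<close> values of \<open>c\<close>.

  That \<open>\<phi>\<^sub>q\<close> is well defined and has the stated values rests on two facts. First, the Galois group
  is the full affine group: \<open>X\<^sup>q - 2\<close> stays irreducible over the cyclotomic field, because otherwise
  the \<open>q\<close>-th root of 2 would lie in that field together with all its conjugates, which are real and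
  therefore equal to it. Second, in an irreducible representation of dimension other than 1
  the translations have no common fixed vector, so the sum of their matrices is zero; this determines
  the character up to the dimension, and the dimension is \<open>q - 1\<close> because the homotheties permute the
  eigenlines of a translation simply transitively.
\<close>

subsection \<open>Cyclotomic polynomials of prime order\<close>

text \<open>\<open>phi\<close> is a definite description, so nothing about its values is accessible
  until one irreducible representation of dimension other than 1 has been exhibited and all of them
  have been shown to share one character. Uniqueness is derived from the multiplication law of the
  affine group alone: eigenvectors and invariant subspaces take the place of Schur's lemma and the
  orthogonality relations. Existence comes from an explicit model by monomial matrices.

  The hypothesis on \<open>\<sigma>\<close> offers, for each pair q, p, some prime ideal P above p
  and a congruence modulo P. What can be read off is the multiplier a modulo q and whether q divides
  b, and the formula for the character depends on nothing else. Reading them off requires reduction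
  modulo P to be injective on q-th roots of unity, where \<open>p \<noteq> q\<close> enters, and 2
  to lie outside P, where odd p enters.

  Group elements are parametrised by natural numbers a and b, which count only modulo q; this is why
  \<open>q - 1\<close> plays the part of -1 throughout.\<close>

lemma eisenstein_aux:
  fixes P g h :: "int poly" and p :: int
  assumes p: "Factorial_Ring.prime p" and lead: "\<not> p dvd lead_coeff P"
    and low: "\<And>i. i < degree P \<Longrightarrow> p dvd coeff P i"
    and P: "P = g * h" and deg: "degree g < degree P" and h0: "\<not> p dvd coeff h 0"
  shows False
proof -
  have "\<not> p dvd lead_coeff g"
    using lead unfolding P lead_coeff_mult by (metis dvd_mult2)
  \<comment> \<open>k is the lowest index at which g survives modulo p. In the convolution for
    coefficient k of P every other term is divisible by p, which leaves
    \<open>coeff g k * coeff h 0\<close>.\<close>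
  define k where "k = (LEAST k. \<not> p dvd coeff g k)"
  have k: "\<not> p dvd coeff g k"
    unfolding k_def using \<open>\<not> p dvd lead_coeff g\<close> by (rule LeastI)
  have k_le: "k \<le> degree g"
    unfolding k_def using \<open>\<not> p dvd lead_coeff g\<close> by (rule Least_le)
  have min: "p dvd coeff g i" if "i < k" for i
    using that not_less_Least unfolding k_def by blast
  have "coeff P k = (\<Sum>i\<le>k. coeff g i * coeff h (k - i))"
    by (simp add: P coeff_mult)
  also have "\<dots> = (\<Sum>i<k. coeff g i * coeff h (k - i)) + coeff g k * coeff h 0"
    by (simp add: lessThan_Suc_atMost[symmetric])
  finally have "coeff g k * coeff h 0 = coeff P k - (\<Sum>i<k. coeff g i * coeff h (k - i))"
    by simp
  moreover have "p dvd coeff P k"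
    using low k_le deg by simp
  moreover have "p dvd (\<Sum>i<k. coeff g i * coeff h (k - i))"
    by (intro dvd_sum) (simp add: min)
  ultimately have "p dvd coeff g k * coeff h 0"
    by (simp add: dvd_diff)
  then show False
    using k h0 p by (simp add: prime_dvd_mult_iff)
qed

text \<open>Since p^2 does not divide the constant coefficient, p misses the constant coefficient of
  one of the two factors; the other factor then takes the role of g in
  \<open>eisenstein_aux\<close>.\<close>

lemma eisenstein:
  fixes P :: "int poly" and p :: int
  assumes p: "Factorial_Ring.prime p" and deg: "0 < degree P" and lead: "\<not> p dvd lead_coeff P"
    and low: "\<And>i. i < degree P \<Longrightarrow> p dvd coeff P i" and const: "\<not> p ^ 2 dvd coeff P 0"
  shows "irreducible\<^sub>d P"
proof (rule irreducible\<^sub>dI)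
  fix g h assume gh: "0 < degree g" "degree g < degree P" "0 < degree h" "degree h < degree P"
    and P: "P = g * h"
  have "coeff P 0 = coeff g 0 * coeff h 0"
    by (simp add: P coeff_mult)
  then have "\<not> p dvd coeff g 0 \<or> \<not> p dvd coeff h 0"
    using const mult_dvd_mono[of p _ p] by (auto simp: power2_eq_square)
  then show False
    using eisenstein_aux[OF p lead low P gh(2)] eisenstein_aux[OF p lead low _ gh(4), of g] P
    by (auto simp: mult.commute)
qed (use deg in auto)

section \<open>Rational polynomials evaluated at complex numbers\<close>

definition rpoly :: "rat poly \<Rightarrow> complex \<Rightarrow> complex" where
  "rpoly F z = poly (map_poly of_rat F) z"

interpretation of_rat_complex: map_poly_comm_ring_hom "of_rat :: rat \<Rightarrow> complex"
  by unfold_locales (auto simp: of_rat_add of_rat_mult)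

lemma rpoly_0 [simp]: "rpoly 0 z = 0"
  and rpoly_1 [simp]: "rpoly 1 z = 1"
  and rpoly_add [simp]: "rpoly (F + G) z = rpoly F z + rpoly G z"
  and rpoly_diff [simp]: "rpoly (F - G) z = rpoly F z - rpoly G z"
  and rpoly_mult [simp]: "rpoly (F * G) z = rpoly F z * rpoly G z"
  and rpoly_power [simp]: "rpoly (F ^ n) z = rpoly F z ^ n"
  by (simp_all add: rpoly_def hom_distribs)

lemma rpoly_pCons [simp]: "rpoly (pCons c F) z = of_rat c + z * rpoly F z"
  by (cases "c = 0 \<and> F = 0") (auto simp: rpoly_def map_poly_pCons)

lemma rpoly_monom [simp]: "rpoly (monom c n) z = of_rat c * z ^ n"
  by (simp add: rpoly_def map_poly_monom poly_monom)

lemma rpoly_pcompose [simp]: "rpoly (F \<circ>\<^sub>p G) z = rpoly F (rpoly G z)"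
  by (induction F) (simp_all add: pcompose_pCons)

lemma rpoly_altdef: "rpoly F z = (\<Sum>i\<le>degree F. of_rat (coeff F i) * z ^ i)"
  by (simp add: rpoly_def poly_altdef)

lemma rpoly_cnj: "rpoly F (cnj z) = cnj (rpoly F z)"
proof (induction F)
  case (pCons c F)
  have "cnj (of_rat c) = of_rat c"
    by (cases c) (simp add: of_rat_rat)
  with pCons show ?case by simp
qed simp

text \<open>By Bezout the gcd also vanishes at z, so it is not constant; irreducibility then makes
  its cofactor in S constant.\<close>

lemma irreducible_dvd_of_common_root:
  fixes S F :: "rat poly"
  assumes irr: "irreducible\<^sub>d S" and "rpoly S z = 0" "rpoly F z = 0"
  shows "S dvd F"
proof -
  define d where "d = gcd S F"
  obtain a b where "a * S + b * F = d"
    unfolding d_def using bezout_coefficients_fst_snd by blast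
  then have "rpoly d z = 0"
    using assms by (metis add.right_neutral mult_zero_right rpoly_add rpoly_mult)
  obtain e where e: "S = d * e"
    unfolding d_def by (meson dvdE gcd_dvd1)
  have S0: "0 < degree S"
    using irr unfolding irreducible\<^sub>d_def by auto
  then have nz: "d \<noteq> 0" "e \<noteq> 0"
    using e by auto
  have "degree d \<noteq> 0"
  proof
    assume "degree d = 0"
    then obtain c where "d = [:c:]"
      by (rule degree_eq_zeroE)
    then show False
      using \<open>rpoly d z = 0\<close> nz by simp
  qed
  moreover have "degree S = degree d + degree e"
    using e nz by (simp add: degree_mult_eq)
  ultimately have "degree e = 0"
    using irreducible\<^sub>dD(2)[OF irr, of d e] e by fastforce
  then obtain c where "e = [:c:]"
    by (rule degree_eq_zeroE)
  then have "S dvd d"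
    using e nz by (simp add: smult_dvd)
  then show ?thesis
    unfolding d_def by simp
qed

text \<open>The polynomial \<open>((X + 1)\<^sup>q - 1) / X\<close>, to which Eisenstein's criterion applies.\<close>

definition shifted_cyclotomic :: "nat \<Rightarrow> int poly" where
  "shifted_cyclotomic q = (\<Sum>i<q. monom (int (q choose Suc i)) i)"

lemma coeff_shifted_cyclotomic:
  "coeff (shifted_cyclotomic q) i = (if i < q then int (q choose Suc i) else 0)"
  by (simp add: shifted_cyclotomic_def coeff_sum if_distrib cong: if_cong)

lemma degree_shifted_cyclotomic:
  assumes "q > 0"
  shows "degree (shifted_cyclotomic q) = q - 1"
proof (rule antisym)
  show "degree (shifted_cyclotomic q) \<le> q - 1"
    by (rule degree_le) (auto simp: coeff_shifted_cyclotomic)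
  show "q - 1 \<le> degree (shifted_cyclotomic q)"
    using assms by (intro le_degree) (simp add: coeff_shifted_cyclotomic)
qed

text \<open>The coefficients are binomial: q at index 0, 1 at index q - 1, and multiples of the
  prime q in between.\<close>

lemma irreducible_shifted_cyclotomic:
  assumes q: "Factorial_Ring.prime q"
  shows "irreducible\<^sub>d (shifted_cyclotomic q)"
proof (rule eisenstein[of "int q"])
  have "q > 1"
    using q by (rule prime_gt_1_nat)
  show "Factorial_Ring.prime (int q)"
    using q by simp
  show "0 < degree (shifted_cyclotomic q)"
    using \<open>q > 1\<close> by (simp add: degree_shifted_cyclotomic)
  show "\<not> int q dvd lead_coeff (shifted_cyclotomic q)"
    using \<open>q > 1\<close> by (simp add: degree_shifted_cyclotomic coeff_shifted_cyclotomic)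
  show "int q dvd coeff (shifted_cyclotomic q) i" if "i < degree (shifted_cyclotomic q)" for i
    using that \<open>q > 1\<close> q
    by (auto simp: degree_shifted_cyclotomic coeff_shifted_cyclotomic intro!: dvd_choose_prime)
  show "\<not> (int q)\<^sup>2 dvd coeff (shifted_cyclotomic q) 0"
    using \<open>q > 1\<close> by (auto simp: coeff_shifted_cyclotomic power2_eq_square dest: zdvd_imp_le)
qed

lemma rpoly_shifted_cyclotomic:
  assumes "q > 0"
  shows "z * rpoly (of_int_poly (shifted_cyclotomic q)) z = (1 + z) ^ q - 1"
proof -
  obtain m where q: "q = Suc m"
    using assms gr0_implies_Suc by blast
  have "rpoly (of_int_poly (shifted_cyclotomic q)) z = (\<Sum>i<q. of_nat (q choose Suc i) * z ^ i)"
    unfolding shifted_cyclotomic_def rpoly_def by (simp add: hom_distribs poly_sum poly_monom)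
  then have "z * rpoly (of_int_poly (shifted_cyclotomic q)) z =
      (\<Sum>i\<le>m. of_nat (q choose Suc i) * z ^ Suc i)"
    by (simp add: sum_distrib_left mult_ac q lessThan_Suc_atMost)
  also have "\<dots> = (\<Sum>i\<le>q. of_nat (q choose i) * z ^ i) - 1"
    unfolding q sum.atMost_Suc_shift[of _ m] by simp
  also have "(\<Sum>i\<le>q. of_nat (q choose i) * z ^ i) = (1 + z) ^ q"
    using binomial_ring[of z 1 q] by (simp add: add.commute)
  finally show ?thesis .
qed

text \<open>All nontrivial q-th roots of unity are conjugate over the rationals, so a rational
  relation for one holds for every other. Irreducibility is known for the polynomial shifted by 1,
  hence the substitution of X + 1 in F.\<close>

lemma rpoly_root_of_unity_transfer:
  assumes q: "Factorial_Ring.prime q" and z: "z ^ q = 1" "z \<noteq> 1" and w: "w ^ q = 1" "w \<noteq> 1"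
    and F: "rpoly F z = 0"
  shows "rpoly F w = 0"
proof -
  have "q > 0"
    using q by (rule prime_gt_0_nat)
  let ?S = "of_int_poly (shifted_cyclotomic q) :: rat poly"
  have root: "rpoly ?S (u - 1) = 0" if "u ^ q = 1" "u \<noteq> 1" for u
    using rpoly_shifted_cyclotomic[OF \<open>q > 0\<close>, of "u - 1"] that by simp
  have "?S dvd F \<circ>\<^sub>p [:1, 1:]"
  proof (rule irreducible_dvd_of_common_root)
    show "irreducible\<^sub>d ?S"
      using irreducible_shifted_cyclotomic[OF q] by (rule irreducible\<^sub>d_int_rat)
    show "rpoly ?S (z - 1) = 0"
      using root z by blast
  qed (simp add: F)
  then obtain H where "F \<circ>\<^sub>p [:1, 1:] = ?S * H"
    by blast
  then have "rpoly (F \<circ>\<^sub>p [:1, 1:]) (w - 1) = 0"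
    using root[OF w] by simp
  then show ?thesis
    by simp
qed

subsection \<open>Simple extensions and embeddings of subfields of the complex numbers\<close>

text \<open>Fields are sets of complex numbers, so that polynomials over them remain complex
  polynomials and their roots need no change of type. The convention \<open>inverse 0 = 0\<close>
  lets closure under \<open>inverse\<close> be stated for all elements.\<close>

locale complex_subfield =
  fixes K :: "complex set"
  assumes zero: "0 \<in> K" and one: "1 \<in> K"
    and add: "\<And>x y. \<lbrakk>x \<in> K; y \<in> K\<rbrakk> \<Longrightarrow> x + y \<in> K"
    and minus: "\<And>x. x \<in> K \<Longrightarrow> - x \<in> K"
    and mult: "\<And>x y. \<lbrakk>x \<in> K; y \<in> K\<rbrakk> \<Longrightarrow> x * y \<in> K"
    and inverse: "\<And>x. x \<in> K \<Longrightarrow> inverse x \<in> K"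
begin

lemma diff: "\<lbrakk>x \<in> K; y \<in> K\<rbrakk> \<Longrightarrow> x - y \<in> K"
  using add[of x "- y"] minus by simp

lemma divide: "\<lbrakk>x \<in> K; y \<in> K\<rbrakk> \<Longrightarrow> x / y \<in> K"
  using mult[of x "inverse y"] inverse by (simp add: divide_inverse)

lemma power: "x \<in> K \<Longrightarrow> x ^ n \<in> K"
  by (induction n) (auto intro: one mult)

lemma of_nat: "of_nat n \<in> K"
  by (induction n) (auto intro: zero one add)

lemma of_int: "of_int n \<in> K"
  by (cases n) (auto intro: of_nat minus simp del: of_nat_Suc)

lemma Rats: "\<rat> \<subseteq> K"
proof
  fix x :: complex assume "x \<in> \<rat>"
  then obtain a b :: int where "x = of_int a / of_int b"
    by (rule Rats_cases')
  then show "x \<in> K"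
    using divide[OF of_int of_int] by simp
qed

lemma sum: "(\<And>i. i \<in> A \<Longrightarrow> h i \<in> K) \<Longrightarrow> sum h A \<in> K"
  by (induction A rule: infinite_finite_induct) (auto intro: zero add)

definition polys :: "complex poly set" where
  "polys = {f. \<forall>i. coeff f i \<in> K}"

lemma pCons_in_polys [simp]: "pCons c f \<in> polys \<longleftrightarrow> c \<in> K \<and> f \<in> polys"
proof
  assume "pCons c f \<in> polys"
  then have "coeff (pCons c f) i \<in> K" for i
    by (simp add: polys_def)
  from this[of 0] this[of "Suc i" for i] show "c \<in> K \<and> f \<in> polys"
    by (simp add: polys_def)
qed (simp add: polys_def coeff_pCons split: nat.split)

lemma zero_in_polys [simp]: "0 \<in> polys"
  by (simp add: polys_def zero)

lemma one_in_polys [simp]: "1 \<in> polys"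
  unfolding one_pCons by (simp only: pCons_in_polys zero_in_polys one)

lemma add_in_polys: "\<lbrakk>f \<in> polys; g \<in> polys\<rbrakk> \<Longrightarrow> f + g \<in> polys"
  by (simp add: polys_def add)

lemma minus_in_polys: "f \<in> polys \<Longrightarrow> - f \<in> polys"
  by (simp add: polys_def minus)

lemma diff_in_polys: "\<lbrakk>f \<in> polys; g \<in> polys\<rbrakk> \<Longrightarrow> f - g \<in> polys"
  by (simp add: polys_def diff)

lemma mult_in_polys: "\<lbrakk>f \<in> polys; g \<in> polys\<rbrakk> \<Longrightarrow> f * g \<in> polys"
  by (auto simp: polys_def coeff_mult intro!: sum mult)

lemma smult_in_polys: "\<lbrakk>c \<in> K; f \<in> polys\<rbrakk> \<Longrightarrow> smult c f \<in> polys"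
  by (simp add: polys_def mult)

lemma monom_in_polys: "c \<in> K \<Longrightarrow> monom c n \<in> polys"
  by (simp add: polys_def zero)

lemma coeff_in_K: "f \<in> polys \<Longrightarrow> coeff f i \<in> K"
  by (simp add: polys_def)

text \<open>Long division treats one coefficient at a time and divides only by the leading
  coefficient of g, which lies in K.\<close>

lemma mod_in_polys: "\<lbrakk>f \<in> polys; g \<in> polys\<rbrakk> \<Longrightarrow> f mod g \<in> polys"
proof (induction f)
  case (pCons c f)
  then show ?case
    unfolding mod_pCons_eq
    by (auto intro!: diff_in_polys smult_in_polys divide coeff_in_K)
qed simp

lemma div_in_polys: "\<lbrakk>f \<in> polys; g \<in> polys\<rbrakk> \<Longrightarrow> f div g \<in> polys"
proof (induction f)
  case (pCons c f)
  then show ?case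
    by (simp add: div_pCons_eq)
      (intro impI divide coeff_in_K; simp add: mod_in_polys)
qed simp

text \<open>This is the ring K[x]; it coincides with the field K(x) once x is algebraic over K, see
  \<open>complex_subfield_adjoin\<close>.\<close>

definition adjoin :: "complex \<Rightarrow> complex set" where
  "adjoin x = (\<lambda>f. poly f x) ` polys"

lemma adjoin_memI: "f \<in> polys \<Longrightarrow> poly f x \<in> adjoin x"
  by (simp add: adjoin_def)

lemma subset_adjoin: "K \<subseteq> adjoin x"
proof
  fix c assume "c \<in> K"
  then show "c \<in> adjoin x"
    using adjoin_memI[of "[:c:]" x] by simp
qed

lemma generator_in_adjoin: "x \<in> adjoin x"
  using adjoin_memI[of "[:0, 1:]" x] by (simp add: zero one)

lemma minimal_polynomial_exists:
  assumes "N \<in> polys" "N \<noteq> 0" "poly N x = 0"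
  obtains g where "g \<in> polys" "g \<noteq> 0" "poly g x = 0"
    "\<And>f. \<lbrakk>f \<in> polys; poly f x = 0; f \<noteq> 0\<rbrakk> \<Longrightarrow> degree g \<le> degree f"
proof -
  let ?P = "\<lambda>g. g \<in> polys \<and> g \<noteq> 0 \<and> poly g x = 0"
  define g where "g = arg_min degree ?P"
  have "?P N" using assms by blast
  then have "?P g"
    unfolding g_def by (rule arg_min_natI)
  moreover have "degree g \<le> degree f" if "?P f" for f
    unfolding g_def using that by (rule arg_min_nat_le)
  ultimately show ?thesis using that by blast
qed

text \<open>Euclid's algorithm applied to the minimal polynomial \<open>g\<close> and \<open>f\<close>.\<close>

lemma inverse_of_poly_value:
  assumes g: "g \<in> polys" "g \<noteq> 0" "poly g x = 0"
    and min: "\<And>f. \<lbrakk>f \<in> polys; poly f x = 0; f \<noteq> 0\<rbrakk> \<Longrightarrow> degree g \<le> degree f"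
    and "f \<in> polys" "poly f x \<noteq> 0" "degree f < degree g"
  shows "\<exists>h\<in>polys. poly f x * poly h x = 1"
  using assms(5-)
proof (induction "degree f" arbitrary: f rule: less_induct)
  case less
  show ?case
  proof (cases "degree f = 0")
    case True
    then obtain c where "f = [:c:]"
      by (rule degree_eq_zeroE)
    with less.prems show ?thesis
      by (intro bexI[of _ "[:inverse c:]"]) (auto intro: inverse)
  next
    case False
    define s r where "s = g div f" and "r = g mod f"
    have sr: "s \<in> polys" "r \<in> polys"
      unfolding s_def r_def using less.prems g by (auto intro: div_in_polys mod_in_polys)
    have "g = f * s + r"
      unfolding s_def r_def by simp
    then have eq: "poly f x * poly s x + poly r x = 0"
      using g by (metis poly_add poly_mult)
    have "f \<noteq> 0" using False by auto
    have "degree r < degree f"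
      using degree_mod_less[of f g] \<open>f \<noteq> 0\<close> False unfolding r_def by auto
    have "s \<noteq> 0"
      using \<open>g = f * s + r\<close> \<open>degree r < degree f\<close> less.prems by auto
    have "degree s < degree g"
      unfolding s_def using False less.prems by (intro Polynomial.degree_div_less) auto
    \<comment> \<open>Here minimality enters: s is nonzero of degree below that of g, so it cannot
      vanish at x. Hence the remainder does not vanish at x either, and the induction applies to
      it.\<close>
    then have "poly s x \<noteq> 0"
      using min sr \<open>s \<noteq> 0\<close> by force
    then have "poly r x \<noteq> 0"
      using eq less.prems by auto
    then obtain h where h: "h \<in> polys" "poly r x * poly h x = 1"
      using less.hyps[of r] sr less.prems \<open>degree r < degree f\<close> by auto
    have "poly f x * poly (- s * h) x = - (poly f x * poly s x) * poly h x"
      by simp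
    also have "- (poly f x * poly s x) = poly r x"
      using eq by (metis add_eq_0_iff)
    finally have "poly f x * poly (- s * h) x = 1"
      using h by simp
    then show ?thesis
      using sr h by (blast intro: mult_in_polys minus_in_polys)
  qed
qed

lemma complex_subfield_adjoin:
  assumes N: "N \<in> polys" "N \<noteq> 0" "poly N x = 0"
  shows "complex_subfield (adjoin x)"
proof
  show "0 \<in> adjoin x" "1 \<in> adjoin x"
    using adjoin_memI[of 0] adjoin_memI[of 1] by simp_all
  show "u + v \<in> adjoin x" "u * v \<in> adjoin x" if "u \<in> adjoin x" "v \<in> adjoin x" for u v
    using that unfolding adjoin_def
    by (auto simp flip: poly_add poly_mult intro: add_in_polys mult_in_polys)
  show "- u \<in> adjoin x" if "u \<in> adjoin x" for u
    using that unfolding adjoin_def by (auto simp flip: poly_minus intro: minus_in_polys)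
  show "inverse u \<in> adjoin x" if u: "u \<in> adjoin x" for u
  proof (cases "u = 0")
    case False
    obtain g where g: "g \<in> polys" "g \<noteq> 0" "poly g x = 0"
      and min: "\<And>f. \<lbrakk>f \<in> polys; poly f x = 0; f \<noteq> 0\<rbrakk> \<Longrightarrow> degree g \<le> degree f"
      using minimal_polynomial_exists[OF N] by blast
    obtain f where f: "f \<in> polys" "u = poly f x"
      using u unfolding adjoin_def by blast
    \<comment> \<open>Reduction modulo g keeps the value at x and brings the degree below that of g,
      as the Euclidean argument requires.\<close>
    have "f = g * (f div g) + f mod g" by simp
    then have mod_root: "poly (f mod g) x = u"
      using f g by (metis add_0 mult_zero_left poly_add poly_mult)
    moreover have "degree (f mod g) < degree g"
      using degree_mod_less[of g f] g mod_root False
      by (metis poly_0)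
    ultimately obtain h where "h \<in> polys" "u * poly h x = 1"
      using inverse_of_poly_value[OF g min, of "f mod g"] f g False mod_in_polys by auto
    then show ?thesis
      using adjoin_memI[of h x] by (metis inverse_unique)
  qed (use adjoin_memI[of 0 x] in simp)
qed

section \<open>Embeddings of a subfield and their extension to a simple extension\<close>

definition embedding :: "(complex \<Rightarrow> complex) \<Rightarrow> bool" where
  "embedding s \<longleftrightarrow> s 1 = 1 \<and> (\<forall>x\<in>K. \<forall>y\<in>K. s (x + y) = s x + s y \<and> s (x * y) = s x * s y)"

context
  fixes s assumes s: "embedding s"
begin

lemma embedding_1: "s 1 = 1"
  and embedding_add: "\<lbrakk>x \<in> K; y \<in> K\<rbrakk> \<Longrightarrow> s (x + y) = s x + s y"
  and embedding_mult: "\<lbrakk>x \<in> K; y \<in> K\<rbrakk> \<Longrightarrow> s (x * y) = s x * s y"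
  using s unfolding embedding_def by blast+

lemma embedding_0: "s 0 = 0"
  using embedding_add[of 0 0] zero by simp

lemma embedding_minus: "x \<in> K \<Longrightarrow> s (- x) = - s x"
  using embedding_add[of x "- x"] embedding_0 minus by (simp add: eq_neg_iff_add_eq_0 add.commute)

lemma embedding_diff: "\<lbrakk>x \<in> K; y \<in> K\<rbrakk> \<Longrightarrow> s (x - y) = s x - s y"
  using embedding_add[of x "- y"] embedding_minus minus by simp

lemma embedding_power: "x \<in> K \<Longrightarrow> s (x ^ n) = s x ^ n"
  by (induction n) (auto simp: embedding_1 embedding_mult power)

lemma embedding_eq_0_iff: "x \<in> K \<Longrightarrow> s x = 0 \<longleftrightarrow> x = 0"
  using embedding_mult[of x "inverse x"] inverse embedding_1 embedding_0
  by (cases "x = 0") auto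

lemma embedding_eq_iff: "\<lbrakk>x \<in> K; y \<in> K\<rbrakk> \<Longrightarrow> s x = s y \<longleftrightarrow> x = y"
  using embedding_eq_0_iff[of "x - y"] embedding_diff diff by auto

lemma embedding_of_nat: "s (of_nat n) = of_nat n"
  by (induction n) (simp_all add: embedding_0 embedding_1 embedding_add one of_nat)

lemma embedding_of_int: "s (of_int n) = of_int n"
proof (cases "n \<ge> 0")
  case True
  then show ?thesis
    using embedding_of_nat[of "nat n"] by simp
next
  case False
  then show ?thesis
    using embedding_of_nat[of "nat (- n)"] embedding_minus[of "of_int n"] of_int[of n]
    by simp
qed

lemma embedding_Rats: "x \<in> \<rat> \<Longrightarrow> s x = x"
proof (elim Rats_cases')
  fix a b :: int assume ab: "b > 0" "x = of_int a / of_int b"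
  then have "of_int a = x * of_int b"
    by simp
  moreover have "x \<in> K"
    using ab by (auto intro: divide of_int)
  ultimately have "of_int a = s x * of_int b"
    using embedding_mult[of x "of_int b"] of_int by (metis embedding_of_int)
  then have "s x * of_int b = x * of_int b"
    using \<open>of_int a = x * of_int b\<close> by metis
  then show "s x = x"
    using ab by (simp only: mult_cancel_right) simp
qed

lemma embedding_sum: "(\<And>i. i \<in> A \<Longrightarrow> h i \<in> K) \<Longrightarrow> s (sum h A) = (\<Sum>i\<in>A. s (h i))"
  by (induction A rule: infinite_finite_induct) (auto simp: embedding_0 embedding_add sum)

lemma map_poly_embedding_add:
  "\<lbrakk>f \<in> polys; g \<in> polys\<rbrakk> \<Longrightarrow> map_poly s (f + g) = map_poly s f + map_poly s g"
  by (intro poly_eqI) (simp add: coeff_map_poly embedding_0 embedding_add coeff_in_K)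

lemma map_poly_embedding_diff:
  "\<lbrakk>f \<in> polys; g \<in> polys\<rbrakk> \<Longrightarrow> map_poly s (f - g) = map_poly s f - map_poly s g"
  by (intro poly_eqI) (simp add: coeff_map_poly embedding_0 embedding_diff coeff_in_K)

lemma map_poly_embedding_mult:
  "\<lbrakk>f \<in> polys; g \<in> polys\<rbrakk> \<Longrightarrow> map_poly s (f * g) = map_poly s f * map_poly s g"
  by (intro poly_eqI)
    (simp add: coeff_map_poly embedding_0 coeff_mult embedding_sum embedding_mult coeff_in_K mult)

lemma map_poly_embedding_pCons: "map_poly s (pCons c f) = pCons (s c) (map_poly s f)"
  by (intro poly_eqI) (simp add: coeff_map_poly embedding_0 coeff_pCons split: nat.splits)

text \<open>The value at f(x) has to be the transported polynomial at y; the kernel condition makes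
  this independent of the representative f. The conclusion is spelled out because
  \<open>embedding\<close> for \<open>adjoin x\<close> can be unfolded only when
  \<open>adjoin x\<close> is known to be a subfield.\<close>

lemma embedding_extension:
  assumes ker: "\<forall>f\<in>polys. poly f x = 0 \<longrightarrow> poly (map_poly s f) y = 0"
  shows "\<exists>t. t 1 = 1 \<and> (\<forall>u\<in>adjoin x. \<forall>v\<in>adjoin x. t (u + v) = t u + t v \<and> t (u * v) = t u * t v) \<and>
    (\<forall>c\<in>K. t c = s c) \<and> t x = y"
proof -
  define t where "t u = poly (map_poly s (SOME f. f \<in> polys \<and> poly f x = u)) y" for u
  have t: "t (poly f x) = poly (map_poly s f) y" if f: "f \<in> polys" for f
  proof -
    define g where "g = (SOME g. g \<in> polys \<and> poly g x = poly f x)"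
    have g: "g \<in> polys \<and> poly g x = poly f x"
      unfolding g_def by (rule someI[of _ f]) (use f in simp)
    then have "poly (map_poly s (g - f)) y = 0"
      using f ker diff_in_polys[of g f] by simp
    then show ?thesis
      unfolding t_def g_def[symmetric] using f g by (simp add: map_poly_embedding_diff)
  qed
  have K: "t c = s c" if "c \<in> K" for c
    using t[of "[:c:]"] that by (simp add: map_poly_embedding_pCons)
  show ?thesis
  proof (intro exI conjI ballI)
    show "t 1 = 1"
      using K[OF one] embedding_1 by simp
    show "t x = y"
      using t[of "[:0, 1:]"] by (simp add: zero one map_poly_embedding_pCons embedding_0 embedding_1)
    fix u v assume "u \<in> adjoin x" "v \<in> adjoin x"
    then obtain f g where "f \<in> polys" "u = poly f x" "g \<in> polys" "v = poly g x"
      unfolding adjoin_def by blast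
    then show "t (u + v) = t u + t v" "t (u * v) = t u * t v"
      using t[of "f + g"] t[of "f * g"]
      by (simp_all add: t add_in_polys mult_in_polys map_poly_embedding_add map_poly_embedding_mult)
  qed (rule K)
qed

end

lemma prod_list_root_const:
  assumes "\<forall>r\<in>set rs. \<exists>z\<in>K. r = a * z"
  shows "\<exists>z\<in>K. poly (\<Prod>r\<leftarrow>rs. [:- r, 1:]) 0 = a ^ length rs * z"
  using assms
proof (induction rs)
  case (Cons r rs)
  then obtain z w where zw: "z \<in> K" "poly (\<Prod>r\<leftarrow>rs. [:- r, 1:]) 0 = a ^ length rs * z"
    "w \<in> K" "r = a * w"
    by auto
  then show ?case
    by (intro bexI[of _ "- (w * z)"]) (simp_all add: minus mult algebra_simps)
next
  case Nil
  show ?case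
    using one by (intro bexI[of _ 1]) simp_all
qed

text \<open>
  If a proper factor \<open>g\<close> of \<open>X\<^sup>q - a\<^sup>q\<close> had coefficients in \<open>K\<close>, its constant coefficient would be a
  multiple of \<open>a\<close> to the power \<open>degree g\<close>, which is coprime to \<open>q\<close>.
\<close>

lemma kummer_minimal_polynomial:
  assumes q: "Factorial_Ring.prime q" and roots: "\<And>z. z ^ q = 1 \<Longrightarrow> z \<in> K"
    and a: "a ^ q \<in> K" "a \<notin> K" and f: "f \<in> polys" "poly f a = 0"
  shows "monom 1 q - [:a ^ q:] dvd f"
proof -
  let ?P = "monom 1 q - [:a ^ q:]"
  have "q > 0"
    using q by (rule prime_gt_0_nat)
  have "a \<noteq> 0"
    using a zero by blast
  have P: "?P \<in> polys"
    using a by (intro diff_in_polys monom_in_polys) (auto intro: one)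
  have deg_P: "degree ?P = q"
    unfolding diff_conv_add_uminus using \<open>q > 0\<close>
    by (subst degree_add_eq_left) (simp_all add: degree_monom_eq)
  have P_roots: "poly ?P z = z ^ q - a ^ q" for z
    unfolding poly_diff poly_monom by simp
  have P0: "?P \<noteq> 0"
    using deg_P \<open>q > 0\<close> by auto
  obtain g where g: "g \<in> polys" "g \<noteq> 0" "poly g a = 0"
    and min: "\<And>f. \<lbrakk>f \<in> polys; poly f a = 0; f \<noteq> 0\<rbrakk> \<Longrightarrow> degree g \<le> degree f"
    using minimal_polynomial_exists[OF P P0, of a] P_roots by auto
  have g_dvd: "g dvd h" if h: "h \<in> polys" "poly h a = 0" for h
  proof (rule ccontr)
    assume "\<not> g dvd h"
    then have "h mod g \<noteq> 0"
      by (simp add: dvd_eq_mod_eq_0)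
    moreover have "h = g * (h div g) + h mod g" by simp
    then have "poly (h mod g) a = 0"
      using g h by (metis add_0 mult_zero_left poly_add poly_mult)
    ultimately have "degree g \<le> degree (h mod g)"
      using min mod_in_polys g h by blast
    then show False
      using degree_mod_less[of g h] g \<open>h mod g \<noteq> 0\<close> by auto
  qed
  obtain k where k: "?P = g * k"
    using g_dvd[OF P] P_roots by auto
  have factor: "z ^ q - a ^ q = poly g z * poly k z" for z
    using P_roots k by (metis poly_mult)
  have "k \<noteq> 0"
    using k P0 by auto
  then have deg: "q = degree g + degree k"
    using arg_cong[OF k, of degree] deg_P g by (simp add: degree_mult_eq)
  have "degree g = q"
  proof (rule ccontr)
    assume "degree g \<noteq> q"
    then have "degree g < q"
      using deg by simp
    obtain rs where rs: "smult (lead_coeff g) (\<Prod>r\<leftarrow>rs. [:- r, 1:]) = g" "length rs = degree g"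
      using fundamental_theorem_algebra_factorized[of g] by blast
    \<comment> \<open>Every root of g is a root of X^q - a^q, so its quotient by a is a q-th root of
      unity and lies in K.\<close>
    have "\<exists>z\<in>K. r = a * z" if "r \<in> set rs" for r
    proof -
      have "poly (\<Prod>r\<leftarrow>rs. [:- r, 1:]) r = 0"
        using that by (auto simp: poly_prod_list prod_list_zero_iff)
      then have "poly g r = 0"
        by (subst rs(1)[symmetric]) simp
      then have "r ^ q = a ^ q"
        using factor[of r] by simp
      then have "(r / a) ^ q = 1"
        using \<open>a \<noteq> 0\<close> by (simp add: power_divide)
      then show ?thesis
        using roots \<open>a \<noteq> 0\<close> by (intro bexI[of _ "r / a"]) auto
    qed
    then obtain z where z: "z \<in> K" "poly (\<Prod>r\<leftarrow>rs. [:- r, 1:]) 0 = a ^ degree g * z"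
      using prod_list_root_const[of rs a] rs(2) by auto
    have const: "poly g 0 = lead_coeff g * z * a ^ degree g"
      using arg_cong[OF rs(1), of "\<lambda>p. poly p 0"] unfolding poly_smult z(2) by (simp only: mult_ac)
    have "poly g 0 \<noteq> 0"
      using factor[of 0] \<open>q > 0\<close> \<open>a \<noteq> 0\<close> by (auto simp: power_0_left)
    then have "lead_coeff g * z \<noteq> 0"
      unfolding const by (metis mult_zero_left)
    then have "a ^ degree g = poly g 0 / (lead_coeff g * z)"
      unfolding const by (metis nonzero_mult_div_cancel_left)
    moreover have "poly g 0 \<in> K"
      unfolding poly_0_coeff_0 using g(1) by (rule coeff_in_K)
    ultimately have ad: "a ^ degree g \<in> K"
      using z(1) coeff_in_K[OF g(1)] divide mult by presburger
    have "degree g \<noteq> 0"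
    proof
      assume "degree g = 0"
      then obtain c where "g = [:c:]"
        by (rule degree_eq_zeroE)
      then show False
        using g by simp
    qed
    \<comment> \<open>Bezout exponents recover a as (a^d)^m / (a^q)^n, where d is the degree of g,
      from two elements of K.\<close>
    then obtain m n where "degree g * m = q * n + gcd (degree g) q"
      using bezout_nat by blast
    moreover have "\<not> q dvd degree g"
      using \<open>degree g < q\<close> \<open>degree g \<noteq> 0\<close> by (auto dest: dvd_imp_le)
    then have "coprime q (degree g)"
      using q by (simp add: Factorial_Ring.prime_imp_coprime)
    then have "gcd (degree g) q = 1"
      by (simp add: gcd.commute)
    ultimately have "degree g * m = q * n + 1"
      by simp
    then have "(a ^ degree g) ^ m = (a ^ q) ^ n * a"
      unfolding power_mult[symmetric] by simp
    moreover have "(a ^ q) ^ n \<noteq> 0"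
      using \<open>a \<noteq> 0\<close> by simp
    ultimately have "(a ^ degree g) ^ m / (a ^ q) ^ n = a"
      by (metis nonzero_mult_div_cancel_left)
    then have "a \<in> K"
      using divide[OF power[OF ad, of m] power[OF a(1), of n]] by (rule subst)
    then show False
      using a by blast
  qed
  then have "degree k = 0"
    using deg by simp
  then obtain c where "k = [:c:]"
    by (rule degree_eq_zeroE)
  then have "?P dvd g"
    using k \<open>k \<noteq> 0\<close> by (simp add: smult_dvd)
  then show ?thesis
    using g_dvd[OF f] dvd_trans by blast
qed

end

subsection \<open>Roots of unity and the root of 2\<close>

abbreviation zeta :: "nat \<Rightarrow> complex" where
  "zeta q \<equiv> e2pi (1 / real q)"

abbreviation radical :: "nat \<Rightarrow> complex" where
  "radical q \<equiv> complex_of_real (root q 2)"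

lemma e2pi_cis: "e2pi t = cis (2 * pi * t)"
  by (simp add: e2pi_def cis_conv_exp mult_ac)

lemma zeta_power: "zeta q ^ k = e2pi (real k / real q)"
  by (simp add: e2pi_cis DeMoivre mult_ac)

lemma bij_betw_zeta_power:
  assumes "q > 0"
  shows "bij_betw (\<lambda>k. zeta q ^ k) {..<q} {z. z ^ q = 1}"
proof -
  have "(\<lambda>k. zeta q ^ k) = (\<lambda>k. cis (2 * pi * real k / real q))"
    unfolding zeta_power by (simp add: e2pi_cis)
  then show ?thesis
    using bij_betw_roots_unity[OF assms] by simp
qed

lemma zeta_power_self: "q > 0 \<Longrightarrow> zeta q ^ q = 1"
  unfolding zeta_power by (simp add: e2pi_cis)

lemma zeta_power_mod:
  assumes "q > 0"
  shows "zeta q ^ (k mod q) = zeta q ^ k"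
proof -
  have "zeta q ^ k = zeta q ^ (q * (k div q) + k mod q)"
    by simp
  also have "\<dots> = zeta q ^ (k mod q)"
    unfolding power_add power_mult zeta_power_self[OF assms] by simp
  finally show ?thesis ..
qed

lemma zeta_power_eq_iff:
  assumes "q > 0"
  shows "zeta q ^ j = zeta q ^ k \<longleftrightarrow> [j = k] (mod q)"
proof -
  have "inj_on (\<lambda>k. zeta q ^ k) {..<q}"
    using bij_betw_zeta_power[OF assms] by (rule bij_betw_imp_inj_on)
  then have "zeta q ^ (j mod q) = zeta q ^ (k mod q) \<longleftrightarrow> j mod q = k mod q"
    using assms by (auto dest: inj_onD)
  then show ?thesis
    by (simp add: zeta_power_mod assms cong_def)
qed

lemma zeta_power_eq_1_iff: "q > 0 \<Longrightarrow> zeta q ^ k = 1 \<longleftrightarrow> q dvd k"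
  using zeta_power_eq_iff[of q k 0] by (simp add: cong_0_iff)

lemma zeta_neq_1: "q > 1 \<Longrightarrow> zeta q \<noteq> 1"
  using zeta_power_eq_1_iff[of q 1] by simp

lemma root_of_unity_cases:
  assumes "q > 0" "z ^ q = 1"
  obtains k where "z = zeta q ^ k"
  using bij_betw_imp_surj_on[OF bij_betw_zeta_power[OF assms(1)]] assms(2) by blast

lemma sum_powers_root_of_unity:
  fixes z :: complex
  assumes "z ^ q = 1" "q > 0"
  shows "(\<Sum>k<q. z ^ k) = (if z = 1 then of_nat q else 0)"
  using assms by (simp add: sum_gp_strict)

text \<open>The conjugate is the inverse; writing it as a power with natural exponent turns complex
  conjugation into a polynomial substitution.\<close>

lemma cnj_root_of_unity:
  assumes "z ^ q = 1" "q > 0"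
  shows "cnj z = z ^ (q - 1)"
proof -
  have "z * z ^ (q - 1) = 1"
    using assms by (cases q) simp_all
  moreover have "cmod z ^ q = 1"
    using assms(1) by (metis norm_one norm_power)
  then have "cmod z = 1"
    using assms(2) power_eq_imp_eq_base[of "cmod z" q 1] by simp
  then have "z * cnj z = 1"
    by (simp add: complex_norm_square[symmetric])
  ultimately show ?thesis
    by (metis mult_left_cancel mult_zero_left zero_neq_one)
qed

lemma radical_power: "q > 0 \<Longrightarrow> radical q ^ q = 2"
  by (simp flip: of_real_power)

lemma radical_nonzero: "q > 0 \<Longrightarrow> radical q \<noteq> 0"
  by simp

lemma algebraic_int_of_power:
  fixes z :: complex
  assumes "z ^ n = of_int c" "n > 0"
  shows "algebraic_int z"
proof (rule algebraic_int_root[where p = "monom 1 n" and x = z])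
  show "algebraic_int (poly (monom 1 n) z)"
    using assms by (simp add: poly_monom)
qed (use assms in \<open>auto simp: degree_monom_eq coeff_monom\<close>)

text \<open>A rational algebraic integer is an integer n, and n > 1 would force n^q to be at least
  2^q, which exceeds 2.\<close>

lemma radical_irrational:
  assumes "q > 1"
  shows "radical q \<notin> \<rat>"
proof
  assume "radical q \<in> \<rat>"
  moreover have "algebraic_int (radical q)"
    using algebraic_int_of_power[of "radical q" q 2] radical_power assms by simp
  ultimately have "radical q \<in> \<int>"
    by (simp add: rational_algebraic_int_is_int)
  then obtain n :: int where n: "radical q = of_int n"
    by (rule Ints_cases)
  then have root: "root q 2 = of_int n"
    by (metis of_real_eq_iff of_real_of_int_eq)
  moreover have "1 < root q 2"
    using assms by simp
  ultimately have "n \<ge> 2"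
    unfolding root by linarith
  have "(of_int n :: real) ^ q = 2"
    unfolding root[symmetric] using assms by simp
  then have "n ^ q = 2"
    by (simp flip: of_int_power)
  moreover have "n ^ q \<ge> 2 ^ q"
    using \<open>n \<ge> 2\<close> by (intro power_mono) auto
  moreover have "(2 :: int) ^ q > 2"
    using power_strict_increasing[of 1 q "2 :: int"] assms by simp
  ultimately show False by simp
qed

text \<open>A fixed monomial summed over all q-th roots of unity gives q or 0. The trivial root is
  included in order to have complete power sums.\<close>

lemma sum_rpoly_roots_of_unity_rational:
  assumes "q > 0"
  shows "(\<Sum>k<q. rpoly F (zeta q ^ k)) \<in> \<rat>"
proof -
  have "(\<Sum>k<q. rpoly F (zeta q ^ k)) =
      (\<Sum>i\<le>degree F. of_rat (coeff F i) * (\<Sum>k<q. (zeta q ^ i) ^ k))"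
    unfolding rpoly_altdef
    by (subst sum.swap) (simp add: sum_distrib_left power_mult[symmetric] mult.commute)
  moreover have "(\<Sum>k<q. (zeta q ^ i) ^ k) \<in> \<rat>" for i
  proof -
    have "(zeta q ^ i) ^ q = 1"
      by (metis assms mult.commute power_mult power_one zeta_power_self)
    then show ?thesis
      using assms by (simp add: sum_powers_root_of_unity)
  qed
  then have "of_rat (coeff F i) * (\<Sum>k<q. (zeta q ^ i) ^ k) \<in> \<rat>" for i
    by (intro Rats_mult Rats_of_rat)
  then have "(\<Sum>i\<le>degree F. of_rat (coeff F i) * (\<Sum>k<q. (zeta q ^ i) ^ k)) \<in> \<rat>"
    by (rule Rats_sum)
  ultimately show ?thesis
    by (rule ssubst)
qed

text \<open>
  If \<open>F(\<zeta>)\<close> were the real \<open>q\<close>-th root of 2, then so would be every conjugate \<open>F(\<zeta>\<^sup>k)\<close>, because each of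
  them is real; summing over \<open>k\<close> makes the root rational.
\<close>

lemma radical_notin_cyclotomic:
  assumes q: "Factorial_Ring.prime q" "odd q"
  shows "rpoly F (zeta q) \<noteq> radical q"
proof
  assume F: "rpoly F (zeta q) = radical q"
  have "q > 1"
    using q(1) by (rule prime_gt_1_nat)
  then have "q > 0" by simp
  have conj: "rpoly F w = radical q" if w: "w ^ q = 1" "w \<noteq> 1" for w
  proof -
    note transfer = rpoly_root_of_unity_transfer[OF q(1) zeta_power_self[OF \<open>q > 0\<close>] zeta_neq_1[OF \<open>q > 1\<close>] w]
    \<comment> \<open>At q-th roots of unity this rational polynomial takes the value F(u) minus its
      conjugate. Its vanishing says that F(u) is real, and this can be transferred from
      \<open>zeta q\<close> to w.\<close>
    have G: "rpoly (F - F \<circ>\<^sub>p monom 1 (q - 1)) u = rpoly F u - cnj (rpoly F u)"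
      if "u ^ q = 1" for u
      using cnj_root_of_unity[OF that \<open>q > 0\<close>] by (simp flip: rpoly_cnj)
    have "rpoly (F - F \<circ>\<^sub>p monom 1 (q - 1)) (zeta q) = 0"
      unfolding G[OF zeta_power_self[OF \<open>q > 0\<close>]] F by simp
    then have "rpoly (F - F \<circ>\<^sub>p monom 1 (q - 1)) w = 0"
      by (rule transfer)
    then have "cnj (rpoly F w) = rpoly F w"
      unfolding G[OF w(1)] by simp
    then have "rpoly F w \<in> \<real>"
      by (simp add: Reals_cnj_iff)
    then obtain r where r: "rpoly F w = of_real r"
      by (rule Reals_cases)
    \<comment> \<open>A second transferred relation: the real number F(w) has q-th power 2, and for
      odd q there is only one such real number.\<close>
    have "rpoly (F ^ q - [:2:]) w = 0"
      by (intro transfer) (simp add: F radical_power \<open>q > 0\<close>)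
    then have "complex_of_real (r ^ q) = complex_of_real 2"
      by (simp add: r)
    then have "r ^ q = 2"
      by (simp only: of_real_eq_iff)
    then have "root q 2 = r"
      using q(2) by (simp add: odd_real_root_unique)
    then show ?thesis
      by (simp add: r)
  qed
  \<comment> \<open>The term at k = 0 is F(1), which is rational but not a conjugate of the others,
    so it is split off.\<close>
  have "(\<Sum>k<q. rpoly F (zeta q ^ k)) = rpoly F 1 + (\<Sum>k\<in>{1..<q}. rpoly F (zeta q ^ k))"
    using \<open>q > 0\<close> by (simp add: lessThan_atLeast0 sum.atLeast_Suc_lessThan)
  also have "(\<Sum>k\<in>{1..<q}. rpoly F (zeta q ^ k)) = (\<Sum>k\<in>{1..<q}. radical q)"
  proof (intro sum.cong refl conj)
    fix k assume "k \<in> {1..<q}"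
    then show "zeta q ^ k \<noteq> 1"
      using zeta_power_eq_1_iff[OF \<open>q > 0\<close>] by (auto dest: dvd_imp_le)
    show "(zeta q ^ k) ^ q = 1"
      by (metis \<open>q > 0\<close> mult.commute power_mult power_one zeta_power_self)
  qed
  finally have "of_nat (q - 1) * radical q = (\<Sum>k<q. rpoly F (zeta q ^ k)) - rpoly F 1"
    by simp
  moreover have "rpoly F 1 \<in> \<rat>"
    by (auto simp: rpoly_altdef intro!: Rats_sum)
  ultimately have "of_nat (q - 1) * radical q \<in> \<rat>"
    using sum_rpoly_roots_of_unity_rational[OF \<open>q > 0\<close>, of F] by (metis Rats_diff)
  then have "of_nat (q - 1) * radical q / of_nat (q - 1) \<in> \<rat>"
    by (rule Rats_divide) simp
  then show False
    using radical_irrational[OF \<open>q > 1\<close>] \<open>q > 1\<close> by simp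
qed

interpretation Rats: complex_subfield \<rat>
  by unfold_locales auto

lemma Rats_polysE:
  assumes "f \<in> Rats.polys"
  obtains F where "f = map_poly of_rat F"
proof -
  define r where "r c = (if c \<in> \<rat> then (SOME x. of_rat x = c) else 0)" for c :: complex
  have r: "of_rat (r c) = c" if "c \<in> \<rat>" for c
    using that someI_ex[of "\<lambda>x. of_rat x = c"] unfolding r_def by (auto elim: Rats_cases)
  have "r 0 = 0"
    using r[of 0] by simp
  then have "f = map_poly of_rat (map_poly r f)"
    using assms r by (intro poly_eqI) (simp add: coeff_map_poly Rats.coeff_in_K)
  then show ?thesis
    by (rule that)
qed

context complex_subfield
begin

lemma embedding_cong_adjoin:
  assumes L: "complex_subfield (adjoin x)"
    and t: "complex_subfield.embedding (adjoin x) t" "complex_subfield.embedding (adjoin x) t'"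
    and K: "\<And>c. c \<in> K \<Longrightarrow> t c = t' c" and x: "t x = t' x" and z: "z \<in> adjoin x"
  shows "t z = t' z"
proof -
  interpret L: complex_subfield "adjoin x" by (rule L)
  have "t (poly f x) = t' (poly f x)" if "f \<in> polys" for f
    using that
  proof (induction f)
    case (pCons c f)
    then have "c \<in> adjoin x" "poly f x \<in> adjoin x" "c \<in> K" "t (poly f x) = t' (poly f x)"
      using subset_adjoin adjoin_memI by auto
    then show ?case
      by (simp add: L.embedding_add[OF t(1)] L.embedding_add[OF t(2)] L.embedding_mult[OF t(1)]
          L.embedding_mult[OF t(2)] L.mult generator_in_adjoin K x)
  qed (simp add: L.embedding_0[OF t(1)] L.embedding_0[OF t(2)])
  then show ?thesis
    using z unfolding adjoin_def by blast
qed

lemma embedding_into_adjoin: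
  assumes L: "complex_subfield (adjoin x)" and t: "complex_subfield.embedding (adjoin x) t"
    and M: "complex_subfield M" and K: "\<And>c. c \<in> K \<Longrightarrow> t c \<in> M" and x: "t x \<in> M"
    and z: "z \<in> adjoin x"
  shows "t z \<in> M"
proof -
  interpret L: complex_subfield "adjoin x" by (rule L)
  interpret M: complex_subfield M by (rule M)
  have "t (poly f x) \<in> M" if "f \<in> polys" for f
    using that
  proof (induction f)
    case (pCons c f)
    then have "c \<in> adjoin x" "poly f x \<in> adjoin x" "c \<in> K" "t (poly f x) \<in> M"
      using subset_adjoin adjoin_memI by auto
    then show ?case
      by (simp add: L.embedding_add[OF t] L.embedding_mult[OF t] L.mult generator_in_adjoin K x
          M.add M.mult)
  qed (simp add: L.embedding_0[OF t] M.zero)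
  then show ?thesis
    using z unfolding adjoin_def by blast
qed

lemma embedding_cong:
  assumes s: "embedding s" and eq: "\<And>x. x \<in> K \<Longrightarrow> t x = s x"
  shows "embedding t"
  unfolding embedding_def
proof (intro conjI ballI)
  show "t 1 = 1"
    using eq[OF one] embedding_1[OF s] by simp
  show "t (x + y) = t x + t y" "t (x * y) = t x * t y" if "x \<in> K" "y \<in> K" for x y
    using that by (simp_all add: eq add mult embedding_add[OF s] embedding_mult[OF s])
qed

lemma embedding_subset:
  assumes "complex_subfield M" "complex_subfield.embedding M t" "K \<subseteq> M"
  shows "embedding t"
  using assms unfolding embedding_def complex_subfield.embedding_def[OF assms(1)] by blast

end

subsection \<open>The Galois group\<close>

definition cyclotomic_field :: "nat \<Rightarrow> complex set" where
  "cyclotomic_field q = Rats.adjoin (zeta q)"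

text \<open>The field is built as a tower of two simple extensions, so that an automorphism can be
  extended one generator at a time; \<open>Lfield_eq\<close> identifies it with
  \<open>Lfield q\<close>.\<close>

definition radical_field :: "nat \<Rightarrow> complex set" where
  "radical_field q = complex_subfield.adjoin (cyclotomic_field q) (radical q)"

locale odd_prime =
  fixes q :: nat
  assumes prime: "Factorial_Ring.prime q" and odd: "odd q"
begin

lemma q_gt_2: "q > 2"
  using prime odd prime_gt_1_nat[of q] by (cases "q = 2") auto

lemma q_pos: "q > 0" and q_gt_1: "q > 1"
  using q_gt_2 by auto

lemmas zeta_power_eq_iff = zeta_power_eq_iff[OF q_pos]
  and zeta_power_eq_1_iff = zeta_power_eq_1_iff[OF q_pos]
  and zeta_power_self = zeta_power_self[OF q_pos]
  and zeta_neq_1 = zeta_neq_1[OF q_gt_1]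
  and radical_power = radical_power[OF q_pos]

lemma radical_nonzero: "radical q \<noteq> 0"
  using q_pos by simp

lemma zeta_power_power_self: "(zeta q ^ k) ^ q = 1"
  by (metis mult.commute power_mult power_one zeta_power_self)

sublocale K: complex_subfield "cyclotomic_field q"
  unfolding cyclotomic_field_def
proof (rule Rats.complex_subfield_adjoin)
  show "monom 1 q - 1 \<in> Rats.polys"
    by (intro Rats.diff_in_polys Rats.monom_in_polys) simp_all
  have "poly (monom 1 q - 1) 0 \<noteq> (0 :: complex)"
    using q_pos by (simp add: poly_monom power_0_left)
  then show "monom 1 q - 1 \<noteq> (0 :: complex poly)"
    by (metis poly_0)
  show "poly (monom 1 q - 1) (zeta q) = 0"
    by (simp add: poly_monom zeta_power_self)
qed

lemma zeta_in_K: "zeta q \<in> cyclotomic_field q"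
  unfolding cyclotomic_field_def by (rule Rats.generator_in_adjoin)

lemma radical_polynomial_in_polys: "monom 1 q - [:2:] \<in> K.polys"
  using K.of_int[of 2] by (intro K.diff_in_polys K.monom_in_polys) (simp_all add: K.one)

lemma poly_radical_polynomial: "poly (monom 1 q - [:2:]) z = z ^ q - 2" for z :: complex
  by (simp add: poly_monom)

sublocale L: complex_subfield "radical_field q"
  unfolding radical_field_def
proof (rule K.complex_subfield_adjoin)
  show "monom 1 q - [:2:] \<in> K.polys"
    by (rule radical_polynomial_in_polys)
  have "poly (monom 1 q - [:2:]) 0 \<noteq> (0 :: complex)"
    unfolding poly_radical_polynomial using q_pos by (simp add: power_0_left)
  then show "monom 1 q - [:2:] \<noteq> (0 :: complex poly)"
    by (metis poly_0)
  show "poly (monom 1 q - [:2:]) (radical q) = 0"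
    unfolding poly_radical_polynomial by (simp add: radical_power)
qed

lemma K_subset_L: "cyclotomic_field q \<subseteq> radical_field q"
  unfolding radical_field_def by (rule K.subset_adjoin)

lemma zeta_in_L: "zeta q \<in> radical_field q"
  using zeta_in_K K_subset_L by blast

lemma radical_in_L: "radical q \<in> radical_field q"
  unfolding radical_field_def by (rule K.generator_in_adjoin)

lemma radical_notin_K: "radical q \<notin> cyclotomic_field q"
proof
  assume "radical q \<in> cyclotomic_field q"
  then obtain f where f: "f \<in> Rats.polys" "radical q = poly f (zeta q)"
    unfolding cyclotomic_field_def Rats.adjoin_def by blast
  obtain F where "f = map_poly of_rat F"
    using f(1) by (rule Rats_polysE)
  then show False
    using f(2) radical_notin_cyclotomic[OF prime odd, of F] by (simp add: rpoly_def)
qed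

lemma Lfield_eq: "Lfield q = radical_field q"
proof
  show "Lfield q \<subseteq> radical_field q"
  proof
    fix x assume "x \<in> Lfield q"
    then show "x \<in> radical_field q"
      unfolding Lfield_def
    proof induction
      case (incl h)
      then show ?case
        using L.Rats zeta_in_L radical_in_L by auto
    qed (auto simp: class_ring_simps L.one L.add L.mult L.minus L.inverse)
  qed
next
  have add: "u + v \<in> Lfield q" and mult: "u * v \<in> Lfield q" if "u \<in> Lfield q" "v \<in> Lfield q" for u v
    using generate_field.eng_add[OF that[unfolded Lfield_def]]
      generate_field.eng_mult[OF that[unfolded Lfield_def]] by (simp_all add: Lfield_def)
  have Rats: "c \<in> Lfield q" if "c \<in> \<rat>" for c
    unfolding Lfield_def using that by (intro generate_field.incl) simp
  have gens: "zeta q \<in> Lfield q" "radical q \<in> Lfield q"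
    by (simp_all add: generate_field.incl Lfield_def)
  have cyclo: "poly f (zeta q) \<in> Lfield q" if "f \<in> Rats.polys" for f
    using that by (induction f) (auto intro!: add mult gens intro: Rats)
  have "poly f (radical q) \<in> Lfield q" if "f \<in> K.polys" for f
    using that
  proof (induction f)
    case (pCons c f)
    then have "c \<in> cyclotomic_field q"
      by simp
    then have "c \<in> Lfield q"
      using cyclo unfolding cyclotomic_field_def Rats.adjoin_def by blast
    then show ?case
      using pCons by (auto intro!: add mult gens)
  qed (simp add: Rats)
  then show "radical_field q \<subseteq> Lfield q"
    unfolding radical_field_def K.adjoin_def by blast
qed

text \<open>Every rational relation of \<open>zeta q\<close> also holds for its power with exponent
  a, a nontrivial root of unity; this is the kernel condition for extending the identity of the
  rationals.\<close>

lemma cyclotomic_embedding_exists: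
  assumes a: "\<not> q dvd a"
  obtains s where "K.embedding s" "s (zeta q) = zeta q ^ a"
proof -
  have id: "Rats.embedding (\<lambda>x. x)"
    by (simp add: Rats.embedding_def)
  have ker: "poly (map_poly (\<lambda>x. x) f) (zeta q ^ a) = 0" if f: "f \<in> Rats.polys" "poly f (zeta q) = 0" for f
  proof -
    obtain F where F: "f = map_poly of_rat F"
      using f(1) by (rule Rats_polysE)
    have "rpoly F (zeta q) = 0"
      using f(2) by (simp add: F rpoly_def)
    with a have "rpoly F (zeta q ^ a) = 0"
      using rpoly_root_of_unity_transfer[OF prime zeta_power_self zeta_neq_1 zeta_power_power_self]
      by (simp add: zeta_power_eq_1_iff)
    then show ?thesis
      by (simp add: F rpoly_def)
  qed
  have "\<exists>t. K.embedding t \<and> t (zeta q) = zeta q ^ a"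
    using Rats.embedding_extension[OF id, of "zeta q" "zeta q ^ a"] ker
    unfolding K.embedding_def unfolding cyclotomic_field_def by blast
  then show ?thesis
    using that by blast
qed

text \<open>A polynomial over the cyclotomic field that vanishes at \<open>radical q\<close> is a
  multiple of X^q - 2. Since s fixes X^q - 2, the transported polynomial vanishes at every root of
  X^q - 2, so the image of \<open>radical q\<close> may be prescribed independently of a.\<close>

lemma radical_embedding_exists:
  assumes a: "\<not> q dvd a"
  obtains t where "L.embedding t" "t (zeta q) = zeta q ^ a" "t (radical q) = zeta q ^ b * radical q"
proof -
  obtain s where s: "K.embedding s" "s (zeta q) = zeta q ^ a"
    using a by (rule cyclotomic_embedding_exists)
  have roots: "z \<in> cyclotomic_field q" if "z ^ q = 1" for z
    using q_pos that by (rule root_of_unity_cases) (simp add: K.power zeta_in_K)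
  have two: "radical q ^ q \<in> cyclotomic_field q"
    using K.of_int[of 2] by (simp add: radical_power)
  have map_P: "map_poly s (monom 1 q - [:2:]) = monom 1 q - [:2:]"
  proof -
    have "s 2 = 2"
      using K.embedding_of_int[OF s(1), of 2] by simp
    have "map_poly s (monom 1 q - [:2:]) = map_poly s (monom 1 q) - map_poly s [:2:]"
      using K.of_int[of 2] by (intro K.map_poly_embedding_diff[OF s(1)] K.monom_in_polys)
        (simp_all add: K.one)
    also have "map_poly s (monom 1 q) = monom 1 q"
      using K.embedding_0[OF s(1)] K.embedding_1[OF s(1)] by (simp add: map_poly_monom)
    also have "map_poly s [:2:] = [:2:]"
      using K.map_poly_embedding_pCons[OF s(1), of 2 0] \<open>s 2 = 2\<close> by simp
    finally show ?thesis .
  qed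
  have ker: "poly (map_poly s f) (zeta q ^ b * radical q) = 0"
    if f: "f \<in> K.polys" "poly f (radical q) = 0" for f
  proof -
    have "monom 1 q - [:2:] dvd f"
      using K.kummer_minimal_polynomial[OF prime roots two radical_notin_K f] by (simp add: radical_power)
    then have "f = (monom 1 q - [:2:]) * (f div (monom 1 q - [:2:]))"
      by simp
    moreover have "f div (monom 1 q - [:2:]) \<in> K.polys"
      using f(1) radical_polynomial_in_polys by (rule K.div_in_polys)
    ultimately have "map_poly s f = (monom 1 q - [:2:]) * map_poly s (f div (monom 1 q - [:2:]))"
      using K.map_poly_embedding_mult[OF s(1) radical_polynomial_in_polys] map_P by metis
    moreover have "poly (monom 1 q - [:2:]) (zeta q ^ b * radical q) = 0"
      unfolding poly_radical_polynomial
      by (simp add: power_mult_distrib zeta_power_power_self radical_power)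
    ultimately show ?thesis
      by (metis mult_zero_left poly_mult)
  qed
  obtain t where t: "L.embedding t" "t (radical q) = zeta q ^ b * radical q"
    "\<forall>c\<in>cyclotomic_field q. t c = s c"
    using K.embedding_extension[OF s(1), of "radical q" "zeta q ^ b * radical q"] ker
    unfolding L.embedding_def unfolding radical_field_def by blast
  then have "t (zeta q) = zeta q ^ a"
    using s zeta_in_K by simp
  with t show ?thesis
    using that by blast
qed

lemma L_embedding_cong:
  assumes "L.embedding t" "L.embedding t'" "t (zeta q) = t' (zeta q)"
    "t (radical q) = t' (radical q)" "x \<in> radical_field q"
  shows "t x = t' x"
proof -
  have "t c = t' c" if "c \<in> cyclotomic_field q" for c
  proof (rule Rats.embedding_cong_adjoin[of "zeta q" t t' c])
    show "complex_subfield (Rats.adjoin (zeta q))"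
      using K.complex_subfield_axioms unfolding cyclotomic_field_def .
    show "complex_subfield.embedding (Rats.adjoin (zeta q)) t"
      "complex_subfield.embedding (Rats.adjoin (zeta q)) t'"
      using K.embedding_subset[OF L.complex_subfield_axioms _ K_subset_L] assms
      unfolding cyclotomic_field_def by blast+
    show "t c = t' c" if "c \<in> \<rat>" for c
      using that by (simp add: L.embedding_Rats[OF assms(1)] L.embedding_Rats[OF assms(2)])
    show "c \<in> Rats.adjoin (zeta q)"
      using that unfolding cyclotomic_field_def .
  qed (use assms in auto)
  then show ?thesis
    using K.embedding_cong_adjoin[of "radical q" t t' x] L.complex_subfield_axioms assms
    unfolding radical_field_def by blast
qed

lemma L_embedding_into_L:
  assumes "L.embedding t" "t (zeta q) \<in> radical_field q" "t (radical q) \<in> radical_field q"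
    "x \<in> radical_field q"
  shows "t x \<in> radical_field q"
proof -
  have "t c \<in> radical_field q" if "c \<in> cyclotomic_field q" for c
  proof (rule Rats.embedding_into_adjoin[of "zeta q" t _ c])
    show "complex_subfield (Rats.adjoin (zeta q))"
      using K.complex_subfield_axioms unfolding cyclotomic_field_def .
    show "complex_subfield.embedding (Rats.adjoin (zeta q)) t"
      using K.embedding_subset[OF L.complex_subfield_axioms _ K_subset_L] assms
      unfolding cyclotomic_field_def by blast
    show "t c \<in> radical_field q" if "c \<in> \<rat>" for c
      using that L.Rats by (auto simp: L.embedding_Rats[OF assms(1)])
    show "c \<in> Rats.adjoin (zeta q)"
      using that unfolding cyclotomic_field_def .
  qed (use assms L.complex_subfield_axioms in auto)
  then show ?thesis
    using K.embedding_into_adjoin[of "radical q" t "radical_field q" x] L.complex_subfield_axioms assms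
    unfolding radical_field_def by blast
qed

text \<open>The choice is meaningful only if q does not divide a; the values at the two generators
  then determine it on the field. The restriction makes the function extensional, as membership in
  \<open>Bij\<close> demands.\<close>

definition aut :: "nat \<Rightarrow> nat \<Rightarrow> complex \<Rightarrow> complex" where
  "aut a b = restrict (SOME t. L.embedding t \<and> t (zeta q) = zeta q ^ a \<and>
     t (radical q) = zeta q ^ b * radical q) (radical_field q)"

lemma
  assumes "\<not> q dvd a"
  shows aut_embedding: "L.embedding (aut a b)"
    and aut_zeta: "aut a b (zeta q) = zeta q ^ a"
    and aut_radical: "aut a b (radical q) = zeta q ^ b * radical q"
proof -
  define P where "P t \<longleftrightarrow> L.embedding t \<and> t (zeta q) = zeta q ^ a \<and>
    t (radical q) = zeta q ^ b * radical q" for t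
  define t where "t = (SOME t. P t)"
  have aut: "aut a b = restrict t (radical_field q)"
    unfolding aut_def t_def P_def ..
  obtain u where "P u"
    unfolding P_def using radical_embedding_exists[OF assms, of b] by blast
  then have "P t"
    unfolding t_def using someI[of P u] by blast
  then have t: "L.embedding t" "t (zeta q) = zeta q ^ a" "t (radical q) = zeta q ^ b * radical q"
    by (simp_all add: P_def)
  show "L.embedding (aut a b)"
    unfolding aut by (rule L.embedding_cong[of t]) (use t in simp_all)
  show "aut a b (zeta q) = zeta q ^ a" "aut a b (radical q) = zeta q ^ b * radical q"
    unfolding aut using zeta_in_L radical_in_L t by simp_all
qed

lemma aut_extensional: "aut a b \<in> extensional (radical_field q)"
  by (simp add: aut_def)

lemma aut_in_L: "\<lbrakk>\<not> q dvd a; x \<in> radical_field q\<rbrakk> \<Longrightarrow> aut a b x \<in> radical_field q"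
  by (rule L_embedding_into_L)
    (simp_all add: aut_embedding aut_zeta aut_radical L.mult L.power zeta_in_L radical_in_L)

lemma eq_autI:
  assumes a: "\<not> q dvd a" and t: "L.embedding t" "t \<in> extensional (radical_field q)"
    "t (zeta q) = zeta q ^ a" "t (radical q) = zeta q ^ b * radical q"
  shows "t = aut a b"
  using t(2) aut_extensional[of a b]
proof (rule extensionalityI)
  fix x assume "x \<in> radical_field q"
  then show "t x = aut a b x"
    by (rule L_embedding_cong[OF t(1) aut_embedding[OF a], rotated 2])
      (simp_all add: t aut_zeta[OF a] aut_radical[OF a])
qed

lemma aut_eq_iff:
  assumes "\<not> q dvd a" "\<not> q dvd a'"
  shows "aut a b = aut a' b' \<longleftrightarrow> [a = a'] (mod q) \<and> [b = b'] (mod q)"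
proof
  assume eq: "aut a b = aut a' b'"
  have "zeta q ^ a = zeta q ^ a'"
    using aut_zeta[OF assms(1), of b] aut_zeta[OF assms(2), of b'] eq by simp
  moreover have "zeta q ^ b = zeta q ^ b'"
    using aut_radical[OF assms(1), of b] aut_radical[OF assms(2), of b'] eq radical_nonzero by simp
  ultimately show "[a = a'] (mod q) \<and> [b = b'] (mod q)"
    by (simp add: zeta_power_eq_iff)
next
  assume "[a = a'] (mod q) \<and> [b = b'] (mod q)"
  then have "zeta q ^ a = zeta q ^ a'" "zeta q ^ b = zeta q ^ b'"
    by (simp_all add: zeta_power_eq_iff)
  then show "aut a b = aut a' b'"
    using assms by (intro eq_autI[OF _ aut_embedding aut_extensional]) (simp_all add: aut_zeta aut_radical)
qed

lemma not_dvd_mult: "\<lbrakk>\<not> q dvd a; \<not> q dvd a'\<rbrakk> \<Longrightarrow> \<not> q dvd a * a'"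
  using prime by (simp add: prime_dvd_mult_iff)

text \<open>The exponents follow the product of affine matrices: the root of unity with exponent b'
  is raised to the power a by the outer map, which contributes a further exponent b from the
  radical.\<close>

lemma compose_aut:
  assumes a: "\<not> q dvd a" "\<not> q dvd a'"
  shows "compose (radical_field q) (aut a b) (aut a' b') = aut (a * a') (a * b' + b)"
proof (rule eq_autI)
  note [simp] = L.embedding_mult[OF aut_embedding[OF a(1)]] L.embedding_add[OF aut_embedding[OF a(1)]]
    L.embedding_mult[OF aut_embedding[OF a(2)]] L.embedding_add[OF aut_embedding[OF a(2)]]
    L.embedding_1[OF aut_embedding[OF a(1)]] L.embedding_1[OF aut_embedding[OF a(2)]]
    L.embedding_power[OF aut_embedding[OF a(1)]]
    aut_zeta[OF a(1)] aut_zeta[OF a(2)] aut_radical[OF a(1)] aut_radical[OF a(2)]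
    zeta_in_L radical_in_L
  show "L.embedding (compose (radical_field q) (aut a b) (aut a' b'))"
    unfolding L.embedding_def by (simp add: compose_eq L.one L.add L.mult aut_in_L a)
  show "compose (radical_field q) (aut a b) (aut a' b') (zeta q) = zeta q ^ (a * a')"
    by (simp add: compose_eq power_mult)
  show "compose (radical_field q) (aut a b) (aut a' b') (radical q) = zeta q ^ (a * b' + b) * radical q"
    by (simp add: compose_eq L.power power_mult power_add)
qed (use a not_dvd_mult in auto)

lemma aut_1_0: "aut 1 0 = (\<lambda>x\<in>radical_field q. x)"
  by (rule eq_autI[symmetric])
    (use q_gt_1 in \<open>auto simp: L.embedding_def L.one L.add L.mult zeta_in_L radical_in_L\<close>)

text \<open>The inverse of x -> a x + b has slope a' = 1/a and intercept -a' b, where -1 is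
  represented by q - 1. Congruences for both orders of composition are provided.\<close>

lemma inverse_parameters:
  assumes "\<not> q dvd a"
  obtains a' b' where "\<not> q dvd a'" "[a * a' = 1] (mod q)" "[a' * a = 1] (mod q)"
    "[a * b' + b = 0] (mod q)" "[a' * b + b' = 0] (mod q)"
proof -
  obtain a' where a': "[a * a' = 1] (mod q)"
    using cong_solve_coprime_nat[of a q] Factorial_Ring.prime_imp_coprime[OF prime assms]
    by (auto simp: Rings.coprime_commute)
  have "\<not> q dvd a'"
  proof
    assume "q dvd a'"
    then have "[a * a' = 0] (mod q)"
      by (simp add: cong_0_iff)
    then show False
      using a' q_gt_1 by (simp add: cong_def)
  qed
  define b' where "b' = (q - 1) * (a' * b)"
  have "[a' * b + b' = 0] (mod q)"
  proof -
    have "a' * b + b' = q * (a' * b)"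
      using q_gt_1 by (simp add: b'_def algebra_simps)
    then show ?thesis
      by (simp add: cong_0_iff)
  qed
  moreover from this have "[a * (a' * b + b') = a * 0] (mod q)"
    by (rule cong_scalar_left)
  then have "[a * a' * b + a * b' = 0] (mod q)"
    by (simp add: algebra_simps)
  moreover have "[a * a' * b + a * b' = 1 * b + a * b'] (mod q)"
    using a' by (intro cong_add cong_mult cong_refl)
  ultimately have "[a * b' + b = 0] (mod q)"
    by (simp add: cong_def add.commute)
  with \<open>[a' * b + b' = 0] (mod q)\<close> \<open>\<not> q dvd a'\<close> a' show ?thesis
    by (intro that[of a' b']) (simp_all add: mult.commute)
qed

lemma aut_Bij:
  assumes "\<not> q dvd a"
  shows "aut a b \<in> Bij (radical_field q)"
proof -
  obtain a' b' where ab: "\<not> q dvd a'" "[a * a' = 1] (mod q)" "[a * b' + b = 0] (mod q)"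
    using inverse_parameters[OF assms] by metis
  have "aut (a * a') (a * b' + b) = aut 1 0"
    using ab assms q_gt_1 not_dvd_mult by (subst aut_eq_iff) auto
  then have comp: "compose (radical_field q) (aut a b) (aut a' b') = (\<lambda>x\<in>radical_field q. x)"
    using compose_aut[OF assms ab(1)] aut_1_0 by simp
  have "bij_betw (aut a b) (radical_field q) (radical_field q)"
    unfolding bij_betw_def
  proof
    show "inj_on (aut a b) (radical_field q)"
      using L.embedding_eq_iff[OF aut_embedding[OF assms]] by (auto intro!: inj_onI)
    show "aut a b ` radical_field q = radical_field q"
    proof
      show "radical_field q \<subseteq> aut a b ` radical_field q"
      proof
        fix x assume x: "x \<in> radical_field q"
        then have "aut a b (aut a' b' x) = x"
          using fun_cong[OF comp, of x] by (simp add: compose_eq)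
        then show "x \<in> aut a b ` radical_field q"
          using aut_in_L[OF ab(1) x, of b'] by (metis imageI)
      qed
    qed (use aut_in_L[OF assms] in auto)
  qed
  then show ?thesis
    by (simp add: Bij_def aut_extensional)
qed

lemma ring_on_simps [simp]:
  "carrier (ring_on S) = S" "x \<otimes>\<^bsub>ring_on S\<^esub> y = x * y" "x \<oplus>\<^bsub>ring_on S\<^esub> y = x + y"
  "\<one>\<^bsub>ring_on S\<^esub> = 1" "\<zero>\<^bsub>ring_on S\<^esub> = 0"
  by (simp_all add: ring_on_def)

lemma mem_Ggroup_iff: "s \<in> carrier (Ggroup q) \<longleftrightarrow> s \<in> Bij (radical_field q) \<and> L.embedding s"
proof
  assume "s \<in> carrier (Ggroup q)"
  then have "s \<in> Bij (radical_field q)"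
    and s: "s \<in> Ring.ring_hom (ring_on (radical_field q)) (ring_on (radical_field q))"
    unfolding Ggroup_def Gal_def Lfield_eq ring_iso_def by simp_all
  moreover have "L.embedding s"
    unfolding L.embedding_def using ring_hom_one[OF s] ring_hom_add[OF s] ring_hom_mult[OF s] by simp
  ultimately show "s \<in> Bij (radical_field q) \<and> L.embedding s"
    by simp
next
  assume *: "s \<in> Bij (radical_field q) \<and> L.embedding s"
  then have s: "L.embedding s" and bij: "bij_betw s (radical_field q) (radical_field q)"
    by (auto simp: Bij_def)
  have "s \<in> Ring.ring_hom (ring_on (radical_field q)) (ring_on (radical_field q))"
    using bij by (intro ring_hom_memI)
      (auto simp: L.embedding_add[OF s] L.embedding_mult[OF s] L.embedding_1[OF s] bij_betw_apply)
  then show "s \<in> carrier (Ggroup q)"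
    using * bij unfolding Ggroup_def Gal_def Lfield_eq ring_iso_def
    by (simp add: L.embedding_Rats[OF s])
qed

text \<open>The image of \<open>zeta q\<close> is a q-th root of unity other than 1, and the image
  of \<open>radical q\<close> is again a q-th root of 2, hence differs from it by a root of
  unity.\<close>

lemma embedding_eq_autE:
  assumes s: "L.embedding s" "s \<in> extensional (radical_field q)"
  obtains a b where "\<not> q dvd a" "s = aut a b"
proof -
  have "s (zeta q) ^ q = 1"
    unfolding L.embedding_power[OF s(1) zeta_in_L, symmetric] zeta_power_self
    by (rule L.embedding_1[OF s(1)])
  then obtain a where a: "s (zeta q) = zeta q ^ a"
    by (rule root_of_unity_cases[OF q_pos])
  have "s (zeta q) \<noteq> 1"
    using L.embedding_eq_iff[OF s(1) zeta_in_L L.one] L.embedding_1[OF s(1)] zeta_neq_1 by simp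
  then have "\<not> q dvd a"
    unfolding a zeta_power_eq_1_iff .
  have "s (radical q) ^ q = s 2"
    unfolding L.embedding_power[OF s(1) radical_in_L, symmetric] radical_power ..
  also have "s 2 = 2"
    using L.embedding_of_int[OF s(1), of 2] by simp
  finally have "(s (radical q) / radical q) ^ q = 1"
    by (simp add: power_divide radical_power)
  then obtain b where "s (radical q) / radical q = zeta q ^ b"
    by (rule root_of_unity_cases[OF q_pos])
  then have "s (radical q) = zeta q ^ b * radical q"
    using radical_nonzero by (simp add: nonzero_divide_eq_eq)
  then have "s = aut a b"
    using s a \<open>\<not> q dvd a\<close> by (intro eq_autI)
  with \<open>\<not> q dvd a\<close> show ?thesis
    by (rule that)
qed

lemma carrier_Ggroup: "carrier (Ggroup q) = {aut a b | a b. \<not> q dvd a}"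
proof (intro equalityI subsetI)
  fix s assume "s \<in> carrier (Ggroup q)"
  then have "L.embedding s" "s \<in> extensional (radical_field q)"
    unfolding mem_Ggroup_iff by (simp_all add: Bij_imp_extensional)
  then show "s \<in> {aut a b | a b. \<not> q dvd a}"
    by (rule embedding_eq_autE) blast
next
  fix s assume "s \<in> {aut a b | a b. \<not> q dvd a}"
  then show "s \<in> carrier (Ggroup q)"
    unfolding mem_Ggroup_iff using aut_Bij aut_embedding by blast
qed

lemma mult_Ggroup:
  assumes "\<not> q dvd a" "\<not> q dvd a'"
  shows "aut a b \<otimes>\<^bsub>Ggroup q\<^esub> aut a' b' = aut (a * a') (a * b' + b)"
  unfolding Ggroup_def Gal_def Lfield_eq BijGroup_def using assms by (simp add: aut_Bij compose_aut)

lemma one_Ggroup: "\<one>\<^bsub>Ggroup q\<^esub> = aut 1 0"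
  unfolding Ggroup_def Gal_def Lfield_eq BijGroup_def aut_1_0 by simp

end

subsection \<open>Irreducible representations of the affine group\<close>

lemma mat_vec_zero:
  assumes "A \<in> carrier_mat n n"
  shows "A *\<^sub>v 0\<^sub>v n = (0\<^sub>v n :: complex vec)"
  using assms by (intro eq_vecI) auto

lemma mat_mult_entry:
  assumes "A \<in> carrier_mat n n" "B \<in> carrier_mat n n" "i < n" "j < n"
  shows "(A * B) $$ (i, j) = (\<Sum>k<n. A $$ (i, k) * B $$ (k, j))"
  using assms by (simp add: scalar_prod_def lessThan_atLeast0)

lemma mat_trace_comm:
  assumes "A \<in> carrier_mat n n" "B \<in> carrier_mat n n"
  shows "mat_trace (A * B) = mat_trace (B * A)"
proof -
  have "mat_trace (A * B) = (\<Sum>i<n. \<Sum>k<n. A $$ (i, k) * B $$ (k, i))"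
    using assms by (simp add: mat_trace_def scalar_prod_def lessThan_atLeast0)
  also have "\<dots> = (\<Sum>k<n. \<Sum>i<n. B $$ (k, i) * A $$ (i, k))"
    by (subst sum.swap) (simp add: mult.commute)
  also have "\<dots> = mat_trace (B * A)"
    using assms by (simp add: mat_trace_def scalar_prod_def lessThan_atLeast0)
  finally show ?thesis .
qed

lemma mat_trace_one: "mat_trace (1\<^sub>m n) = of_nat n"
  by (simp add: mat_trace_def)

lemma irreducible_representation_invariant:
  assumes irr: "irreducible_representation G n \<rho>" and W: "W \<subseteq> carrier_vec n" "0\<^sub>v n \<in> W"
    and add: "\<And>v w. \<lbrakk>v \<in> W; w \<in> W\<rbrakk> \<Longrightarrow> v + w \<in> W" and smult: "\<And>c v. v \<in> W \<Longrightarrow> c \<cdot>\<^sub>v v \<in> W"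
    and inv: "\<And>g w. \<lbrakk>g \<in> carrier G; w \<in> W\<rbrakk> \<Longrightarrow> \<rho> g *\<^sub>v w \<in> W"
  shows "W = {0\<^sub>v n} \<or> W = carrier_vec n"
proof -
  interpret V: vec_space "TYPE(complex)" n .
  have "subspace class_ring W V.V"
    using W add smult unfolding VectorSpace.subspace_def submodule_def
    by (auto simp: V.module_axioms V.vectorspace_axioms)
  then show ?thesis
    using irr inv unfolding irreducible_representation_def by blast
qed

text \<open>
  A group of order \<open>q (q - 1)\<close> in the form of the affine group of the prime field:
  \<open>t a b\<close> stands for the map \<open>x \<mapsto> a x + b\<close>.
\<close>

locale affine_group = odd_prime q for q :: nat +
  fixes G :: "('g, 'b) monoid_scheme" (structure) and t :: "nat \<Rightarrow> nat \<Rightarrow> 'g"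
  assumes carrier: "carrier G = {t a b | a b. \<not> q dvd a}"
    and eq_iff: "\<lbrakk>\<not> q dvd a; \<not> q dvd a'\<rbrakk> \<Longrightarrow> t a b = t a' b' \<longleftrightarrow> [a = a'] (mod q) \<and> [b = b'] (mod q)"
    and t_mult: "\<lbrakk>\<not> q dvd a; \<not> q dvd a'\<rbrakk> \<Longrightarrow> t a b \<otimes> t a' b' = t (a * a') (a * b' + b)"
    and t_one: "\<one> = t 1 0"
begin

lemma not_dvd_1: "\<not> q dvd 1"
  using q_gt_1 by simp

lemma t_in_carrier: "\<not> q dvd a \<Longrightarrow> t a b \<in> carrier G"
  by (auto simp: carrier)

lemma t_cong: "\<lbrakk>\<not> q dvd a; [a = a'] (mod q); [b = b'] (mod q)\<rbrakk> \<Longrightarrow> t a b = t a' b'"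
  using eq_iff cong_dvd_iff by metis

context
  fixes n \<rho> assumes rep: "representation G n \<rho>"
begin

lemma rep_carrier: "g \<in> carrier G \<Longrightarrow> \<rho> g \<in> carrier_mat n n"
  using rep unfolding representation_def hom_def units_of_def Units_def by (auto simp: ring_mat_def)

lemma rep_mult: "\<lbrakk>g \<in> carrier G; h \<in> carrier G\<rbrakk> \<Longrightarrow> \<rho> (g \<otimes> h) = \<rho> g * \<rho> h"
  using rep unfolding representation_def hom_def units_of_def by (auto simp: ring_mat_def)

lemma rep_t_carrier: "\<not> q dvd a \<Longrightarrow> \<rho> (t a b) \<in> carrier_mat n n"
  by (simp add: rep_carrier t_in_carrier)

lemma rep_t_mult:
  "\<lbrakk>\<not> q dvd a; \<not> q dvd a'\<rbrakk> \<Longrightarrow> \<rho> (t a b) * \<rho> (t a' b') = \<rho> (t (a * a') (a * b' + b))"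
  by (simp add: t_in_carrier rep_mult[symmetric] t_mult)

lemma rep_t_mult_vec:
  "\<lbrakk>\<not> q dvd a; \<not> q dvd a'; v \<in> carrier_vec n\<rbrakk> \<Longrightarrow>
    \<rho> (t a b) *\<^sub>v (\<rho> (t a' b') *\<^sub>v v) = \<rho> (t (a * a') (a * b' + b)) *\<^sub>v v"
  by (subst assoc_mult_mat_vec[symmetric, of _ n n _ n]) (simp_all add: rep_t_carrier rep_t_mult)

lemma rep_t_mult_vec_carrier: "\<lbrakk>\<not> q dvd a; v \<in> carrier_vec n\<rbrakk> \<Longrightarrow> \<rho> (t a b) *\<^sub>v v \<in> carrier_vec n"
  using rep_t_carrier by (rule mult_mat_vec_carrier)

text \<open>Membership in \<open>hom\<close> gives multiplicativity and values in the unit group;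
  the image of the identity is thus an invertible idempotent.\<close>

lemma rep_one: "\<rho> (t 1 0) = 1\<^sub>m n"
proof -
  let ?A = "\<rho> (t 1 0)"
  have A: "?A \<in> carrier_mat n n"
    using rep_t_carrier not_dvd_1 by blast
  have "?A \<in> Units (ring_mat TYPE(complex) n ())"
    using rep t_in_carrier[OF not_dvd_1] unfolding representation_def hom_def units_of_def by auto
  then obtain B where B: "B \<in> carrier_mat n n" "B * ?A = 1\<^sub>m n"
    unfolding Units_def by (auto simp: ring_mat_def)
  have "?A = B * ?A * ?A"
    using A B by simp
  also have "\<dots> = B * (?A * ?A)"
    using A B by (intro assoc_mult_mat)
  also have "?A * ?A = ?A"
    using rep_t_mult[OF not_dvd_1 not_dvd_1, of 0 0] by simp
  finally show ?thesis
    using B by simp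
qed

lemma trace_conj:
  assumes "\<not> q dvd a" "\<not> q dvd a'"
  shows "mat_trace (\<rho> (t (a * a') (a * b' + b))) = mat_trace (\<rho> (t (a' * a) (a' * b + b')))"
  using mat_trace_comm[of "\<rho> (t a b)" n "\<rho> (t a' b')"] assms
  by (simp add: rep_t_carrier rep_t_mult)

text \<open>An affine map with slope other than 1 has a fixed point; conjugation by the translation
  to that point turns the map into a homothety.\<close>

lemma trace_eq_homothety:
  assumes a: "\<not> q dvd a" "\<not> [a = 1] (mod q)"
  shows "mat_trace (\<rho> (t a b)) = mat_trace (\<rho> (t a 0))"
proof -
  have "a \<ge> 1"
    using a(1) by (cases a) auto
  then obtain m where m: "a = Suc m"
    by (cases a) auto
  have "\<not> q dvd m"
  proof
    assume "q dvd m"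
    then have "[m + 1 = 0 + 1] (mod q)"
      by (intro cong_add cong_refl) (simp add: cong_0_iff)
    then show False
      using a(2) by (simp add: m)
  qed
  then obtain m' where m': "[m * m' = 1] (mod q)"
    using inverse_parameters[of m 0] by metis
  \<comment> \<open>Modulo q, c is the fixed point -b / (a - 1) and \<open>b0\<close> below is b -
    c. Then t a b is t 1 c times t a b0, while the product in the other order is t a 0.\<close>
  define c where "c = m' * ((q - 1) * b)"
  have "[m * c = (q - 1) * b] (mod q)"
    using cong_scalar_right[OF m', of "(q - 1) * b"] by (simp add: c_def mult.assoc)
  define b0 where "b0 = b + (q - 1) * c"
  have q1: "(q - 1) * x + x = q * x" for x
    using q_pos by (cases q) simp_all
  have eq1: "1 * b0 + c = b + ((q - 1) * c + c)"
    by (simp add: b0_def)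
  have left: "[1 * b0 + c = b] (mod q)"
    unfolding eq1 q1 by (simp add: cong_def)
  have eq2: "a * c + b0 = b + m * c + ((q - 1) * c + c)"
    by (simp add: m b0_def)
  have "[a * c + b0 = b + m * c] (mod q)"
    unfolding eq2 q1 by (simp add: cong_def)
  also have "[b + m * c = b + (q - 1) * b] (mod q)"
    using \<open>[m * c = (q - 1) * b] (mod q)\<close> by (intro cong_add cong_refl)
  also have "[b + (q - 1) * b = 0] (mod q)"
    using q1[of b] by (simp add: cong_0_iff add.commute)
  finally have right: "[a * c + b0 = 0] (mod q)" .
  have "mat_trace (\<rho> (t (1 * a) (1 * b0 + c))) = mat_trace (\<rho> (t (a * 1) (a * c + b0)))"
    by (rule trace_conj[OF not_dvd_1 a(1)])
  moreover have "t (1 * a) (1 * b0 + c) = t a b"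
    using a left by (intro t_cong) simp_all
  moreover have "t (a * 1) (a * c + b0) = t a 0"
    using a right by (intro t_cong) simp_all
  ultimately show ?thesis
    by simp
qed

lemma trace_eq_translation:
  assumes b: "\<not> q dvd b"
  shows "mat_trace (\<rho> (t 1 b)) = mat_trace (\<rho> (t 1 1))"
proof -
  obtain b' where b': "\<not> q dvd b'" "[b * b' = 1] (mod q)" "[b' * b = 1] (mod q)"
    using inverse_parameters[OF b] by metis
  have "mat_trace (\<rho> (t (b * b') (b * 0 + b))) = mat_trace (\<rho> (t (b' * b) (b' * b + 0)))"
    by (rule trace_conj[OF b b'(1)])
  moreover have "t (b * b') (b * 0 + b) = t 1 b"
    using b b' by (intro t_cong) (simp_all add: not_dvd_mult)
  moreover have "t (b' * b) (b' * b + 0) = t 1 1"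
    using b b' by (intro t_cong) (simp_all add: not_dvd_mult)
  ultimately show ?thesis
    by simp
qed

end

section \<open>Irreducible representations of dimension other than 1\<close>

context
  fixes n \<rho> assumes irr: "irreducible_representation G n \<rho>" and n: "n \<noteq> 1"
begin

lemma rep: "representation G n \<rho>" and n_pos: "n > 0"
  using irr by (simp_all add: irreducible_representation_def)

lemma invariant_cases:
  assumes "W \<subseteq> carrier_vec n" "0\<^sub>v n \<in> W" "\<And>v w. \<lbrakk>v \<in> W; w \<in> W\<rbrakk> \<Longrightarrow> v + w \<in> W"
    "\<And>c v. v \<in> W \<Longrightarrow> c \<cdot>\<^sub>v v \<in> W" "\<And>a b w. \<lbrakk>\<not> q dvd a; w \<in> W\<rbrakk> \<Longrightarrow> \<rho> (t a b) *\<^sub>v w \<in> W"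
  shows "W = {0\<^sub>v n} \<or> W = carrier_vec n"
  using irr assms(1-4)
proof (rule irreducible_representation_invariant)
  show "\<rho> g *\<^sub>v w \<in> W" if "g \<in> carrier G" "w \<in> W" for g w
    using that assms(5) by (auto simp: carrier)
qed

text \<open>If every matrix were scalar, the line through the first unit vector would be invariant,
  hence the whole space; as the dimension is at least 2, the second unit vector does not lie on
  it.\<close>

lemma not_all_scalar: "\<exists>a b. \<not> q dvd a \<and> (\<forall>c. \<exists>v\<in>carrier_vec n. \<rho> (t a b) *\<^sub>v v \<noteq> c \<cdot>\<^sub>v v)"
proof (rule ccontr)
  assume "\<not> ?thesis"
  then have scalar: "\<exists>c. \<forall>v\<in>carrier_vec n. \<rho> (t a b) *\<^sub>v v = c \<cdot>\<^sub>v v" if "\<not> q dvd a" for a b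
    using that by blast
  let ?e = "unit_vec n 0 :: complex vec"
  let ?W = "range (\<lambda>c. c \<cdot>\<^sub>v ?e)"
  have "?W = {0\<^sub>v n} \<or> ?W = carrier_vec n"
  proof (rule invariant_cases)
    show "?W \<subseteq> carrier_vec n"
      by auto
    have "0\<^sub>v n = 0 \<cdot>\<^sub>v ?e"
      by auto
    then show "0\<^sub>v n \<in> ?W"
      by blast
    show "v + w \<in> ?W" if "v \<in> ?W" "w \<in> ?W" for v w
      using that by (auto simp: add_smult_distrib_vec[symmetric])
    show smult: "c \<cdot>\<^sub>v v \<in> ?W" if "v \<in> ?W" for c v
      using that by (auto simp: smult_smult_assoc)
    show "\<rho> (t a b) *\<^sub>v w \<in> ?W" if a: "\<not> q dvd a" and w: "w \<in> ?W" for a b w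
    proof -
      obtain c where c: "\<forall>v\<in>carrier_vec n. \<rho> (t a b) *\<^sub>v v = c \<cdot>\<^sub>v v"
        using scalar[OF a] by blast
      have "w \<in> carrier_vec n"
        using w by auto
      then show ?thesis
        using c smult[OF w, of c] by simp
    qed
  qed
  moreover have "?e \<in> ?W"
    by (rule range_eqI[of _ _ 1]) simp
  moreover have "?e \<noteq> 0\<^sub>v n"
    using n_pos by (metis index_unit_vec(1) index_zero_vec(1) zero_neq_one)
  ultimately have "unit_vec n 1 \<in> ?W"
    by auto
  then obtain c where c: "unit_vec n 1 = c \<cdot>\<^sub>v ?e"
    by blast
  have "(unit_vec n 1 :: complex vec) $ 1 = (c \<cdot>\<^sub>v ?e) $ 1"
    unfolding c ..
  then show False
    using n n_pos by simp
qed

text \<open>Otherwise the matrices would depend on the slope only and would commute. An eigenspace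
  of any of them would then be invariant, so each of them would be scalar.\<close>

lemma translations_not_trivial:
  "\<exists>b. \<exists>v\<in>carrier_vec n. \<rho> (t 1 b) *\<^sub>v v \<noteq> v"
proof (rule ccontr)
  assume "\<not> ?thesis"
  then have triv: "\<rho> (t 1 b) *\<^sub>v v = v" if "v \<in> carrier_vec n" for b v
    using that by blast
  have homothety: "\<rho> (t a b) *\<^sub>v v = \<rho> (t a 0) *\<^sub>v v" if "\<not> q dvd a" "v \<in> carrier_vec n" for a b v
    using rep_t_mult_vec[OF rep not_dvd_1 that, of b 0] triv[OF rep_t_mult_vec_carrier[OF rep that]]
    by simp
  have prod: "\<rho> (t a b) *\<^sub>v (\<rho> (t a' b') *\<^sub>v v) = \<rho> (t (a * a') 0) *\<^sub>v v"
    if "\<not> q dvd a" "\<not> q dvd a'" "v \<in> carrier_vec n" for a b a' b' v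
    unfolding rep_t_mult_vec[OF rep that] by (rule homothety[OF not_dvd_mult[OF that(1,2)] that(3)])
  have comm: "\<rho> (t a b) *\<^sub>v (\<rho> (t a' b') *\<^sub>v v) = \<rho> (t a' b') *\<^sub>v (\<rho> (t a b) *\<^sub>v v)"
    if "\<not> q dvd a" "\<not> q dvd a'" "v \<in> carrier_vec n" for a b a' b' v
    using prod[OF that] prod[OF that(2,1,3)] by (simp add: mult.commute)
  have "\<exists>c. \<forall>v\<in>carrier_vec n. \<rho> (t a b) *\<^sub>v v = c \<cdot>\<^sub>v v" if a: "\<not> q dvd a" for a b
  proof -
    let ?A = "\<rho> (t a b)"
    have A: "?A \<in> carrier_mat n n"
      using rep_t_carrier[OF rep a] .
    obtain c where "eigenvalue ?A c"
      using spectrum_non_empty[OF A n_pos] unfolding spectrum_def by blast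
    then obtain u where u: "u \<in> carrier_vec n" "u \<noteq> 0\<^sub>v n" "?A *\<^sub>v u = c \<cdot>\<^sub>v u"
      using A unfolding eigenvalue_def eigenvector_def by auto
    let ?W = "{v \<in> carrier_vec n. ?A *\<^sub>v v = c \<cdot>\<^sub>v v}"
    have "?W = {0\<^sub>v n} \<or> ?W = carrier_vec n"
    proof (rule invariant_cases)
      show "0\<^sub>v n \<in> ?W"
        using A by (auto simp: mat_vec_zero intro!: eq_vecI)
      show "v + w \<in> ?W" if "v \<in> ?W" "w \<in> ?W" for v w
        using that A by (auto simp: mult_add_distrib_mat_vec smult_add_distrib_vec)
      show "d \<cdot>\<^sub>v v \<in> ?W" if "v \<in> ?W" for d v
        using that A by (auto simp: mult_mat_vec smult_smult_assoc mult.commute)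
      show "\<rho> (t a' b') *\<^sub>v v \<in> ?W" if "\<not> q dvd a'" "v \<in> ?W" for a' b' v
        using that comm[OF a, of a' v b b'] rep_t_mult_vec_carrier[OF rep]
          mult_mat_vec[OF rep_t_carrier[OF rep]] by auto
    qed auto
    then have "?W = carrier_vec n"
      using u by blast
    then show ?thesis
      by blast
  qed
  then show False
    using not_all_scalar by blast
qed

text \<open>The translations form a normal subgroup, so their common fixed space is invariant; it is
  not the whole space by \<open>translations_not_trivial\<close>.\<close>

lemma translation_fixed_vector:
  assumes "v \<in> carrier_vec n" "\<And>b. \<rho> (t 1 b) *\<^sub>v v = v"
  shows "v = 0\<^sub>v n"
proof -
  let ?W = "{v \<in> carrier_vec n. \<forall>b. \<rho> (t 1 b) *\<^sub>v v = v}"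
  have "?W = {0\<^sub>v n} \<or> ?W = carrier_vec n"
  proof (rule invariant_cases)
    show "0\<^sub>v n \<in> ?W"
      using mat_vec_zero[OF rep_t_carrier[OF rep not_dvd_1]] by simp
    show "v + w \<in> ?W" if "v \<in> ?W" "w \<in> ?W" for v w
      using that mult_add_distrib_mat_vec[OF rep_t_carrier[OF rep not_dvd_1]] by auto
    show "d \<cdot>\<^sub>v v \<in> ?W" if "v \<in> ?W" for d v
      using that mult_mat_vec[OF rep_t_carrier[OF rep not_dvd_1]] by auto
    show "\<rho> (t a c) *\<^sub>v v \<in> ?W" if a: "\<not> q dvd a" and v: "v \<in> ?W" for a c v
    proof -
      have "\<rho> (t 1 b) *\<^sub>v (\<rho> (t a c) *\<^sub>v v) = \<rho> (t a c) *\<^sub>v v" for b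
      proof -
        obtain a' where a': "[a * a' = 1] (mod q)"
          using inverse_parameters[OF a] by metis
        have "[a * (a' * b) = b] (mod q)"
          using cong_scalar_right[OF a', of b] by (simp add: mult.assoc)
        then have "[c + b = c + a * (a' * b)] (mod q)"
          by (intro cong_add cong_refl) (rule cong_sym)
        then have "t (1 * a) (1 * c + b) = t (a * 1) (a * (a' * b) + c)"
          using a by (intro t_cong) (simp_all add: add.commute)
        moreover have "v \<in> carrier_vec n"
          using v by blast
        ultimately have "\<rho> (t 1 b) *\<^sub>v (\<rho> (t a c) *\<^sub>v v) = \<rho> (t a c) *\<^sub>v (\<rho> (t 1 (a' * b)) *\<^sub>v v)"
          using rep_t_mult_vec[OF rep not_dvd_1 a, of v b c]
            rep_t_mult_vec[OF rep a not_dvd_1, of v c "a' * b"] by simp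
        also have "\<rho> (t 1 (a' * b)) *\<^sub>v v = v"
          using v by blast
        finally show ?thesis .
      qed
      then show ?thesis
        using v a rep_t_mult_vec_carrier[OF rep] by blast
    qed
  qed auto
  moreover have "?W \<noteq> carrier_vec n"
    using translations_not_trivial by blast
  ultimately show ?thesis
    using assms by blast
qed

lemma sum_translations_shift:
  fixes h :: "'g \<Rightarrow> complex"
  assumes "\<not> q dvd a"
  shows "(\<Sum>b<q. h (t a (b + c))) = (\<Sum>b<q. h (t a b))"
proof -
  have "(\<Sum>b<q. h (t a b)) = (\<Sum>b<q. h (t a ((b + c) mod q)))"
  proof (rule sum.reindex_bij_betw[symmetric])
    have inj: "inj_on (\<lambda>b. (b + c) mod q) {..<q}"
    proof (rule inj_onI)
      fix x y assume "x \<in> {..<q}" "y \<in> {..<q}" "(x + c) mod q = (y + c) mod q"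
      then show "x = y"
        using cong_add_rcancel_nat[of x c y q] by (simp add: cong_def)
    qed
    have "(\<lambda>b. (b + c) mod q) ` {..<q} \<subseteq> {..<q}"
      using q_pos by auto
    then show "bij_betw (\<lambda>b. (b + c) mod q) {..<q} {..<q}"
      using inj by (simp add: bij_betw_def endo_inj_surj)
  qed
  also have "\<dots> = (\<Sum>b<q. h (t a (b + c)))"
    using assms by (intro sum.cong refl arg_cong[of _ _ h] t_cong) simp_all
  finally show ?thesis ..
qed

text \<open>Multiplying by one more translation only permutes the summands, so every column of the
  sum of the translation matrices is fixed by all translations.\<close>

lemma sum_translations_entry_eq_0:
  assumes ij: "i < n" "j < n"
  shows "(\<Sum>b<q. \<rho> (t 1 b) $$ (i, j)) = 0"
proof -
  define v where "v = vec n (\<lambda>i. \<Sum>b<q. \<rho> (t 1 b) $$ (i, j))"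
  note T = rep_t_carrier[OF rep not_dvd_1]
  have "\<rho> (t 1 c) *\<^sub>v v = v" for c
  proof (rule eq_vecI)
    fix k assume "k < dim_vec v"
    then have k: "k < n"
      by (simp add: v_def)
    have "(\<rho> (t 1 c) *\<^sub>v v) $ k = (\<Sum>l<n. \<rho> (t 1 c) $$ (k, l) * (\<Sum>b<q. \<rho> (t 1 b) $$ (l, j)))"
      using T[of c] k by (simp add: v_def scalar_prod_def lessThan_atLeast0)
    also have "\<dots> = (\<Sum>b<q. \<Sum>l<n. \<rho> (t 1 c) $$ (k, l) * \<rho> (t 1 b) $$ (l, j))"
      unfolding sum_distrib_left by (rule sum.swap)
    also have "\<dots> = (\<Sum>b<q. (\<rho> (t 1 c) * \<rho> (t 1 b)) $$ (k, j))"
      using T k ij by (intro sum.cong refl mat_mult_entry[symmetric])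
    also have "\<dots> = (\<Sum>b<q. \<rho> (t 1 (b + c)) $$ (k, j))"
      by (simp add: rep_t_mult[OF rep not_dvd_1 not_dvd_1] del: One_nat_def)
    also have "\<dots> = v $ k"
      using sum_translations_shift[OF not_dvd_1, of "\<lambda>g. \<rho> g $$ (k, j)" c] k by (simp add: v_def)
    finally show "(\<rho> (t 1 c) *\<^sub>v v) $ k = v $ k" .
  qed (use T[of c] in \<open>simp add: v_def\<close>)
  then have "v = 0\<^sub>v n"
    by (intro translation_fixed_vector) (simp_all add: v_def)
  then have "v $ i = 0"
    using ij by simp
  then show ?thesis
    using ij by (simp add: v_def)
qed

text \<open>Each \<open>t a b\<close> is the translation by b times one fixed homothety, so the sum
  over b contains the vanishing sum of translations as a factor.\<close>

lemma sum_traces_eq_0: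
  assumes a: "\<not> q dvd a"
  shows "(\<Sum>b<q. mat_trace (\<rho> (t a b))) = 0"
proof -
  note T = rep_t_carrier[OF rep not_dvd_1] and H = rep_t_carrier[OF rep a]
  have "(\<Sum>b<q. \<rho> (t a b) $$ (i, i)) = 0" if i: "i < n" for i
  proof -
    have "(\<Sum>b<q. \<rho> (t a b) $$ (i, i)) = (\<Sum>b<q. (\<rho> (t 1 b) * \<rho> (t a 0)) $$ (i, i))"
      by (simp add: rep_t_mult[OF rep not_dvd_1 a] del: One_nat_def)
    also have "\<dots> = (\<Sum>b<q. \<Sum>k<n. \<rho> (t 1 b) $$ (i, k) * \<rho> (t a 0) $$ (k, i))"
      using T H i by (intro sum.cong refl mat_mult_entry)
    also have "\<dots> = (\<Sum>k<n. (\<Sum>b<q. \<rho> (t 1 b) $$ (i, k)) * \<rho> (t a 0) $$ (k, i))"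
      unfolding sum_distrib_right by (rule sum.swap)
    also have "\<dots> = 0"
      using i by (intro sum.neutral) (simp add: sum_translations_entry_eq_0 del: One_nat_def)
    finally show ?thesis .
  qed
  moreover have "(\<Sum>b<q. mat_trace (\<rho> (t a b))) = (\<Sum>i<n. \<Sum>b<q. \<rho> (t a b) $$ (i, i))"
  proof -
    have "dim_row (\<rho> (t a b)) = n" for b
      using H[of b] by simp
    then show ?thesis
      unfolding mat_trace_def by (simp only:) (rule sum.swap)
  qed
  ultimately show ?thesis
    by simp
qed

lemma trace_nontranslation:
  assumes "\<not> q dvd a" "\<not> [a = 1] (mod q)"
  shows "mat_trace (\<rho> (t a b)) = 0"
proof -
  have "(\<Sum>b<q. mat_trace (\<rho> (t a b))) = (\<Sum>b<q. mat_trace (\<rho> (t a 0)))"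
    by (intro sum.cong refl trace_eq_homothety[OF rep assms])
  then have "mat_trace (\<rho> (t a 0)) = 0"
    using sum_traces_eq_0[OF assms(1)] q_pos by simp
  then show ?thesis
    unfolding trace_eq_homothety[OF rep assms, of b] .
qed

text \<open>An eigenvector of \<open>t 1 1\<close> is one for all translations, these being powers
  of it. The eigenvalue is a q-th root of unity because the translation by q is the identity, and it
  is not 1 because no nonzero vector is fixed.\<close>

lemma translation_eigenvector_exists:
  obtains v c where "v \<in> carrier_vec n" "v \<noteq> 0\<^sub>v n" "c \<noteq> 1" "c ^ q = 1"
    "\<And>b. \<rho> (t 1 b) *\<^sub>v v = c ^ b \<cdot>\<^sub>v v"
proof -
  note T = rep_t_carrier[OF rep not_dvd_1]
  obtain c where "eigenvalue (\<rho> (t 1 1)) c"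
    using spectrum_non_empty[OF T n_pos] unfolding spectrum_def by blast
  then obtain v where v: "v \<in> carrier_vec n" "v \<noteq> 0\<^sub>v n" "\<rho> (t 1 1) *\<^sub>v v = c \<cdot>\<^sub>v v"
    using T[of 1] unfolding eigenvalue_def eigenvector_def by auto
  have eigen: "\<rho> (t 1 b) *\<^sub>v v = c ^ b \<cdot>\<^sub>v v" for b
  proof (induction b)
    case 0
    then show ?case
      using rep_one[OF rep] v by simp
  next
    case (Suc b)
    have "\<rho> (t 1 (Suc b)) *\<^sub>v v = \<rho> (t 1 1) *\<^sub>v (\<rho> (t 1 b) *\<^sub>v v)"
      using rep_t_mult_vec[OF rep not_dvd_1 not_dvd_1 v(1), of 1 b] by simp
    also have "\<dots> = c ^ b \<cdot>\<^sub>v (c \<cdot>\<^sub>v v)"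
      unfolding Suc mult_mat_vec[OF T v(1)] v(3) ..
    finally show ?case
      by (simp add: smult_smult_assoc mult.commute)
  qed
  have "t 1 q = t 1 0"
    by (intro t_cong not_dvd_1) (simp_all add: cong_def)
  then have "c ^ q \<cdot>\<^sub>v v = v"
    using eigen[of q] rep_one[OF rep] v by simp
  moreover have "\<exists>i<n. v $ i \<noteq> 0"
  proof (rule ccontr)
    assume "\<not> ?thesis"
    then have "v = 0\<^sub>v n"
      using v by (intro eq_vecI) auto
    then show False
      using v by blast
  qed
  then obtain i where i: "i < n" "v $ i \<noteq> 0"
    by blast
  moreover have "(c ^ q \<cdot>\<^sub>v v) $ i = c ^ q * v $ i"
    using v i by simp
  ultimately have "c ^ q * v $ i = v $ i"
    by simp
  then have "c ^ q = 1"
    using i by simp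
  have "c \<noteq> 1"
  proof
    assume "c = 1"
    then have "v = 0\<^sub>v n"
      using v eigen by (intro translation_fixed_vector) simp_all
    then show False
      using v by blast
  qed
  with v eigen \<open>c ^ q = 1\<close> show ?thesis
    by (intro that)
qed

lemma dim_eq: "n = q - 1"
proof -
  note T = rep_t_carrier[OF rep not_dvd_1]
  obtain v c where v: "v \<in> carrier_vec n" "v \<noteq> 0\<^sub>v n" and c: "c \<noteq> 1" "c ^ q = 1"
    and eigen: "\<And>b. \<rho> (t 1 b) *\<^sub>v v = c ^ b \<cdot>\<^sub>v v"
    by (rule translation_eigenvector_exists) blast
  define w where "w a = \<rho> (t a 0) *\<^sub>v v" for a
  have w_carrier: "w a \<in> carrier_vec n" if "\<not> q dvd a" for a
    unfolding w_def using rep_t_mult_vec_carrier[OF rep that v(1)] .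
  \<comment> \<open>Since \<open>t a b\<close> is \<open>t a 0\<close> times the translation by b/a,
    and a' represents 1/a, the vector w a is an eigenvector of \<open>t 1 1\<close> with eigenvalue
    c^a'.\<close>
  have w_mult: "\<rho> (t a b) *\<^sub>v v = c ^ (a' * b) \<cdot>\<^sub>v w a" if a: "\<not> q dvd a" "[a * a' = 1] (mod q)" for a a' b
  proof -
    have "[a * (a' * b) = b] (mod q)"
      using cong_scalar_right[OF a(2), of b] by (simp add: mult.assoc)
    then have "t a b = t (a * 1) (a * (a' * b) + 0)"
      using a by (intro t_cong) (simp_all add: cong_sym)
    then have "\<rho> (t a b) *\<^sub>v v = \<rho> (t a 0) *\<^sub>v (\<rho> (t 1 (a' * b)) *\<^sub>v v)"
      using rep_t_mult_vec[OF rep a(1) not_dvd_1 v(1), of 0 "a' * b"] by simp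
    also have "\<dots> = c ^ (a' * b) \<cdot>\<^sub>v w a"
      using mult_mat_vec[OF rep_t_carrier[OF rep a(1)] v(1)] by (simp only: eigen w_def)
    finally show ?thesis .
  qed
  have w_nonzero: "w a \<noteq> 0\<^sub>v n" if a: "\<not> q dvd a" for a
  proof
    assume "w a = 0\<^sub>v n"
    obtain a' where a': "\<not> q dvd a'" "[a' * a = 1] (mod q)"
      using inverse_parameters[OF a] by metis
    have "t (a' * a) (a' * 0 + 0) = t 1 0"
      using a' a by (intro t_cong) (simp_all add: not_dvd_mult)
    then have "v = \<rho> (t a' 0) *\<^sub>v w a"
      unfolding w_def using rep_t_mult_vec[OF rep a'(1) a v(1), of 0 0] rep_one[OF rep] v by simp
    also have "\<dots> = 0\<^sub>v n"
      using \<open>w a = 0\<^sub>v n\<close> mat_vec_zero[OF rep_t_carrier[OF rep a'(1)]] by simp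
    finally show False
      using v by blast
  qed
  \<comment> \<open>Lower bound for n: the power c^k is attained at w a with a inverse to k, and
    these q - 1 powers turn out to be distinct.\<close>
  have "(\<lambda>k. c ^ k) ` {1..<q} \<subseteq> spectrum (\<rho> (t 1 1))"
  proof
    fix d assume "d \<in> (\<lambda>k. c ^ k) ` {1..<q}"
    then obtain k where k: "k \<in> {1..<q}" "d = c ^ k"
      by blast
    then have "\<not> q dvd k"
      by (auto dest: dvd_imp_le)
    then obtain a where a: "\<not> q dvd a" "[a * k = 1] (mod q)"
      using inverse_parameters by metis
    have "\<rho> (t 1 1) *\<^sub>v w a = \<rho> (t a 1) *\<^sub>v v"
      unfolding w_def using rep_t_mult_vec[OF rep not_dvd_1 a(1) v(1), of 1 0] by simp
    also have "\<dots> = d \<cdot>\<^sub>v w a"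
      using w_mult[OF a, of 1] k by simp
    finally have "eigenvector (\<rho> (t 1 1)) (w a) d"
      using T[of 1] w_carrier[OF a(1)] w_nonzero[OF a(1)] unfolding eigenvector_def by auto
    then show "d \<in> spectrum (\<rho> (t 1 1))"
      unfolding spectrum_def eigenvalue_def by blast
  qed
  moreover have "inj_on (\<lambda>k. c ^ k) {1..<q}"
  proof -
    obtain m where m: "c = zeta q ^ m"
      using c(2) by (rule root_of_unity_cases[OF q_pos])
    have "\<not> q dvd m"
      using c(1) unfolding m zeta_power_eq_1_iff .
    show ?thesis
    proof (rule inj_onI)
      fix k l assume kl: "k \<in> {1..<q}" "l \<in> {1..<q}" "c ^ k = c ^ l"
      then have "[m * k = m * l] (mod q)"
        by (simp add: m power_mult[symmetric] zeta_power_eq_iff)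
      moreover obtain m' where m': "[m' * m = 1] (mod q)"
        using inverse_parameters[OF \<open>\<not> q dvd m\<close>] by metis
      ultimately have "[m' * m * k = m' * m * l] (mod q)"
        unfolding mult.assoc by (simp only: cong_scalar_left)
      moreover have "[m' * m * k = k] (mod q)" "[m' * m * l = l] (mod q)"
        using cong_scalar_right[OF m', of k] cong_scalar_right[OF m', of l] by simp_all
      ultimately have "[k = l] (mod q)"
        by (meson cong_sym cong_trans)
      then show "k = l"
        using kl by (simp add: cong_def)
    qed
  qed
  ultimately have "q - 1 \<le> n"
    using card_finite_spectrum[OF T, of 1] card_mono[of "spectrum (\<rho> (t 1 1))"]
    by (metis card_atLeastLessThan card_image order_trans)
  interpret V: vec_space "TYPE(complex)" n .
  let ?S = "w ` {1..<q}"
  have not_dvd: "\<not> q dvd a" if "a \<in> {1..<q}" for a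
    using that by (auto dest: dvd_imp_le)
  have S: "?S \<subseteq> carrier_vec n"
    using w_carrier not_dvd by blast
  have w_in_S: "w a \<in> ?S" if a: "\<not> q dvd a" for a
  proof -
    have "t a 0 = t (a mod q) 0"
      using a by (intro t_cong) simp_all
    moreover have "a mod q \<in> {1..<q}"
      using a q_pos by (auto simp: dvd_eq_mod_eq_0 Suc_le_eq)
    ultimately show ?thesis
      unfolding w_def by auto
  qed
  have sub: "submodule class_ring (V.span ?S) V.V"
    by (rule V.span_is_submodule) (use S in simp)
  have span_carrier: "V.span ?S \<subseteq> carrier_vec n"
    using V.span_is_subset2[of ?S] S by simp
  have span_add: "x + y \<in> V.span ?S" if "x \<in> V.span ?S" "y \<in> V.span ?S" for x y
    using submodule.m_closed[OF sub that] by simp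
  have span_smult: "k \<cdot>\<^sub>v x \<in> V.span ?S" if "x \<in> V.span ?S" for k x
    using submodule.smult_closed[OF sub _ that, of k] by simp
  have span_0: "0\<^sub>v n \<in> V.span ?S"
    using submodule.zero_closed[OF sub] by simp
  have S_span: "?S \<subseteq> V.span ?S"
    by (rule V.in_own_span) (use S in simp)
  \<comment> \<open>Upper bound for n: the group permutes the lines spanned by the vectors w a, so
    their span is invariant and therefore everything.\<close>
  have "V.span ?S = {0\<^sub>v n} \<or> V.span ?S = carrier_vec n"
  proof (rule invariant_cases[OF span_carrier span_0 span_add span_smult])
    fix a b x assume a: "\<not> q dvd a" and x: "x \<in> V.span ?S"
    let ?N = "{x \<in> carrier_vec n. \<rho> (t a b) *\<^sub>v x \<in> V.span ?S}"
    note A = rep_t_carrier[OF rep a, of b]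
    \<comment> \<open>The preimage of the span under the matrix is a subspace, so it suffices to
      find the generators in it.\<close>
    have "submodule class_ring ?N V.V"
    proof (unfold submodule_def, intro conjI allI impI)
      show "Module.module class_ring V.V"
        by (rule V.module_axioms)
    qed (use A span_0 in \<open>auto simp: mult_add_distrib_mat_vec[OF A] mult_mat_vec[OF A] span_add
        span_smult mat_vec_zero[OF A] simp del: One_nat_def\<close>)
    moreover have "?S \<subseteq> ?N"
    proof
      fix y assume "y \<in> ?S"
      then obtain a2 where a2: "\<not> q dvd a2" "y = w a2"
        using not_dvd by blast
      have aa: "\<not> q dvd a * a2"
        using a a2(1) by (rule not_dvd_mult)
      obtain a3 where a3: "[a * a2 * a3 = 1] (mod q)"
        using inverse_parameters[OF aa] by metis
      have "\<rho> (t a b) *\<^sub>v y = \<rho> (t (a * a2) b) *\<^sub>v v"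
        unfolding a2(2) w_def using rep_t_mult_vec[OF rep a a2(1) v(1), of b 0] by simp
      also have "\<dots> = c ^ (a3 * b) \<cdot>\<^sub>v w (a * a2)"
        using w_mult[OF aa a3] .
      also have "c ^ (a3 * b) \<cdot>\<^sub>v w (a * a2) \<in> V.span ?S"
        using w_in_S[OF aa] S_span by (intro span_smult) blast
      finally have "\<rho> (t a b) *\<^sub>v y \<in> V.span ?S" .
      then show "y \<in> ?N"
        using w_carrier[OF a2(1)] a2(2) by simp
    qed
    ultimately have "V.span ?S \<subseteq> ?N"
      by (intro V.span_is_subset)
    then show "\<rho> (t a b) *\<^sub>v x \<in> V.span ?S"
      using x by blast
  qed
  moreover have "w 1 \<in> V.span ?S"
    using w_in_S[OF not_dvd_1] S_span by blast
  ultimately have "V.span ?S = carrier_vec n"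
    using w_nonzero[OF not_dvd_1] by auto
  then have "V.dim \<le> card ?S"
    using S by (intro V.gen_ge_dim) simp_all
  also have "card ?S \<le> q - 1"
    using card_image_le[of "{1..<q}" w] by simp
  finally have "n \<le> q - 1"
    by (simp add: V.dim_is_n)
  then show ?thesis
    using \<open>q - 1 \<le> n\<close> by simp
qed

text \<open>In the vanishing sum of the translation traces the identity contributes q - 1 and the
  remaining q - 1 terms are equal.\<close>

lemma trace_translation:
  assumes "\<not> q dvd b"
  shows "mat_trace (\<rho> (t 1 b)) = -1"
proof -
  have "0 = (\<Sum>b<q. mat_trace (\<rho> (t 1 b)))"
    using sum_traces_eq_0[OF not_dvd_1] by simp
  also have "\<dots> = mat_trace (\<rho> (t 1 0)) + (\<Sum>b\<in>{1..<q}. mat_trace (\<rho> (t 1 b)))"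
    using q_pos by (simp add: lessThan_atLeast0 sum.atLeast_Suc_lessThan del: One_nat_def)
      (simp only: One_nat_def)
  also have "(\<Sum>b\<in>{1..<q}. mat_trace (\<rho> (t 1 b))) = (\<Sum>b\<in>{1..<q}. mat_trace (\<rho> (t 1 1)))"
    by (intro sum.cong refl trace_eq_translation[OF rep]) (auto dest: dvd_imp_le)
  also have "mat_trace (\<rho> (t 1 0)) = of_nat (q - 1)"
    using rep_one[OF rep] by (simp add: mat_trace_one dim_eq)
  finally have "of_nat (q - 1) * (1 + mat_trace (\<rho> (t 1 1))) = 0"
    by (simp add: algebra_simps)
  then have "1 + mat_trace (\<rho> (t 1 1)) = 0"
    using q_gt_1 by simp
  then show ?thesis
    using trace_eq_translation[OF rep assms] by (simp add: add_eq_0_iff)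
qed

end

end

section \<open>An explicit irreducible representation of dimension q - 1\<close>

context odd_prime
begin

text \<open>Precomposition with multiplication by a sends the additive character number i + 1 to
  number (i + 1) a. Rows are counted from 0 and the trivial character is left out, hence both shifts
  by 1.\<close>

definition idx :: "nat \<Rightarrow> nat \<Rightarrow> nat" where
  "idx i a = (i + 1) * a mod q - 1"

lemma
  assumes "\<not> q dvd a" "i < q - 1"
  shows Suc_idx: "Suc (idx i a) = (i + 1) * a mod q"
    and idx_less: "idx i a < q - 1"
proof -
  have "\<not> q dvd i + 1"
    using assms(2) by (auto dest: dvd_imp_le)
  then have "\<not> q dvd (i + 1) * a"
    using assms(1) by (rule not_dvd_mult)
  then have "(i + 1) * a mod q \<noteq> 0"
    by (simp add: dvd_eq_mod_eq_0)
  then show "Suc (idx i a) = (i + 1) * a mod q"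
    unfolding idx_def by simp
  moreover have "(i + 1) * a mod q < q"
    using q_pos by simp
  ultimately show "idx i a < q - 1"
    by linarith
qed

lemma eq_idx_iff:
  assumes "\<not> q dvd a" "i < q - 1" "j < q - 1"
  shows "j = idx i a \<longleftrightarrow> [(i + 1) * a = j + 1] (mod q)"
proof -
  have "(j + 1) mod q = Suc j"
    using assms(3) by simp
  then show ?thesis
    unfolding cong_def Suc_idx[OF assms(1,2), symmetric] by auto
qed

lemma idx_idx:
  assumes "\<not> q dvd a" "i < q - 1"
  shows "idx (idx i a) a' = idx i (a * a')"
proof -
  have "idx (idx i a) a' = Suc (idx i a) * a' mod q - 1"
    by (simp add: idx_def[of "idx i a"])
  also have "\<dots> = idx i (a * a')"
    unfolding Suc_idx[OF assms] by (simp only: idx_def mod_mult_left_eq mult.assoc)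
  finally show ?thesis .
qed

lemma idx_1: "i < q - 1 \<Longrightarrow> idx i 1 = i"
  by (simp add: idx_def)

text \<open>
  The permutation representation on functions on the prime field, without its trivial
  constituent, in the basis of the nontrivial additive characters; row \<open>i\<close> belongs to the
  character \<open>x \<mapsto> \<zeta>\<^sup>(\<^sup>i\<^sup>+\<^sup>1\<^sup>)\<^sup>x\<close>.
\<close>

definition std_matrix :: "nat \<Rightarrow> nat \<Rightarrow> complex mat" where
  "std_matrix a b = mat (q - 1) (q - 1) (\<lambda>(i, j). if j = idx i a then zeta q ^ ((i + 1) * b) else 0)"

lemma std_matrix_carrier: "std_matrix a b \<in> carrier_mat (q - 1) (q - 1)"
  by (simp add: std_matrix_def)

lemma std_matrix_mult_vec:
  assumes "\<not> q dvd a" "v \<in> carrier_vec (q - 1)" "i < q - 1"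
  shows "(std_matrix a b *\<^sub>v v) $ i = zeta q ^ ((i + 1) * b) * v $ idx i a"
proof -
  have "(std_matrix a b *\<^sub>v v) $ i =
      (\<Sum>k<q - 1. (if k = idx i a then zeta q ^ ((i + 1) * b) else 0) * v $ k)"
    using assms by (simp add: std_matrix_def scalar_prod_def lessThan_atLeast0)
  also have "\<dots> = (\<Sum>k<q - 1. if k = idx i a then zeta q ^ ((i + 1) * b) * v $ k else 0)"
    by (intro sum.cong) auto
  also have "\<dots> = zeta q ^ ((i + 1) * b) * v $ idx i a"
    using idx_less[OF assms(1,3)] by (subst sum.delta) auto
  finally show ?thesis .
qed

lemma std_matrix_mult:
  assumes a: "\<not> q dvd a" "\<not> q dvd a'"
  shows "std_matrix a b * std_matrix a' b' = std_matrix (a * a') (a * b' + b)"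
proof (rule eq_matI)
  fix i j assume "i < dim_row (std_matrix (a * a') (a * b' + b))"
    "j < dim_col (std_matrix (a * a') (a * b' + b))"
  then have ij: "i < q - 1" "j < q - 1"
    by (simp_all add: std_matrix_def)
  let ?k = "idx i a"
  have k: "?k < q - 1"
    using a(1) ij(1) by (rule idx_less)
  have "zeta q ^ ((?k + 1) * b') = zeta q ^ ((i + 1) * a * b')"
    unfolding zeta_power_eq_iff using Suc_idx[OF a(1) ij(1)]
    by (simp add: cong_def mod_mult_left_eq)
  then have exponent: "zeta q ^ ((i + 1) * b) * zeta q ^ ((?k + 1) * b') = zeta q ^ ((i + 1) * (a * b' + b))"
    by (simp add: power_add[symmetric] algebra_simps)
  have col: "col (std_matrix a' b') j \<in> carrier_vec (q - 1)"
    by (simp add: std_matrix_def carrier_vecI)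
  have "(std_matrix a b * std_matrix a' b') $$ (i, j) = (std_matrix a b *\<^sub>v col (std_matrix a' b') j) $ i"
    using ij by (simp add: std_matrix_def)
  also have "\<dots> = zeta q ^ ((i + 1) * b) * std_matrix a' b' $$ (?k, j)"
    unfolding std_matrix_mult_vec[OF a(1) col ij(1)] using k ij by (simp add: std_matrix_def)
  also have "\<dots> = std_matrix (a * a') (a * b' + b) $$ (i, j)"
    using k ij exponent by (simp add: std_matrix_def idx_idx[OF a(1) ij(1)])
  finally show "(std_matrix a b * std_matrix a' b') $$ (i, j) =
    std_matrix (a * a') (a * b' + b) $$ (i, j)" .
qed (simp_all add: std_matrix_def)

lemma std_matrix_cong:
  assumes "[a = a'] (mod q)" "[b = b'] (mod q)"
  shows "std_matrix a b = std_matrix a' b'"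
proof -
  have "idx i a = idx i a'" for i
    using cong_scalar_left[OF assms(1), of "i + 1"] by (simp add: idx_def cong_def)
  moreover have "zeta q ^ ((i + 1) * b) = zeta q ^ ((i + 1) * b')" for i
    unfolding zeta_power_eq_iff using assms(2) by (rule cong_scalar_left)
  ultimately show ?thesis
    unfolding std_matrix_def by (simp only:)
qed

lemma std_matrix_one: "std_matrix 1 0 = 1\<^sub>m (q - 1)"
  by (rule eq_matI) (auto simp: std_matrix_def idx_1 simp del: One_nat_def)

end

context affine_group
begin

text \<open>The matrix depends on the parameters only modulo q, so the choice of a pair that
  represents g is immaterial; this is \<open>std_rep_t\<close>.\<close>

definition std_rep :: "'g \<Rightarrow> complex mat" where
  "std_rep g = (let p = SOME p. \<not> q dvd fst p \<and> g = t (fst p) (snd p) in std_matrix (fst p) (snd p))"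

lemma std_rep_t:
  assumes "\<not> q dvd a"
  shows "std_rep (t a b) = std_matrix a b"
proof -
  define P where "P p \<longleftrightarrow> \<not> q dvd fst p \<and> t a b = t (fst p) (snd p)" for p
  have "P (a, b)"
    using assms by (simp add: P_def)
  then have "P (Eps P)"
    using someI[of P "(a, b)"] by blast
  moreover have std: "std_rep (t a b) = std_matrix (fst (Eps P)) (snd (Eps P))"
    by (simp add: std_rep_def P_def[abs_def] Let_def)
  ultimately have "\<not> q dvd fst (Eps P)" "t a b = t (fst (Eps P)) (snd (Eps P))"
    by (simp_all add: P_def)
  then have "[a = fst (Eps P)] (mod q)" "[b = snd (Eps P)] (mod q)"
    using assms eq_iff by blast+
  then show ?thesis
    unfolding std by (intro std_matrix_cong) (rule cong_sym, assumption)+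
qed

lemma representation_std_rep: "representation G (q - 1) std_rep"
  unfolding representation_def
proof (rule homI)
  fix g assume "g \<in> carrier G"
  then obtain a b where g: "g = t a b" "\<not> q dvd a"
    by (auto simp: carrier)
  obtain a' b' where ab: "\<not> q dvd a'" "[a * a' = 1] (mod q)" "[a' * a = 1] (mod q)"
    "[a * b' + b = 0] (mod q)" "[a' * b + b' = 0] (mod q)"
    using g(2) by (rule inverse_parameters)
  have "std_matrix a b * std_matrix a' b' = 1\<^sub>m (q - 1)"
    unfolding std_matrix_mult[OF g(2) ab(1)] std_matrix_one[symmetric]
    using ab by (intro std_matrix_cong)
  moreover have "std_matrix a' b' * std_matrix a b = 1\<^sub>m (q - 1)"
    unfolding std_matrix_mult[OF ab(1) g(2)] std_matrix_one[symmetric]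
    using ab by (intro std_matrix_cong)
  ultimately show "std_rep g \<in> carrier (units_of (ring_mat TYPE(complex) (q - 1) ()))"
    unfolding units_of_def Units_def g(1) std_rep_t[OF g(2)] using std_matrix_carrier
    by (auto simp: ring_mat_def)
next
  fix g h assume "g \<in> carrier G" "h \<in> carrier G"
  then obtain a b a' b' where gh: "g = t a b" "\<not> q dvd a" "h = t a' b'" "\<not> q dvd a'"
    by (auto simp: carrier)
  then show "std_rep (g \<otimes> h) = std_rep g \<otimes>\<^bsub>units_of (ring_mat TYPE(complex) (q - 1) ())\<^esub> std_rep h"
    by (simp add: t_mult std_rep_t std_matrix_mult not_dvd_mult units_of_def ring_mat_def)
qed

text \<open>From a nonzero invariant subspace the translations extract one unit vector by a discrete
  Fourier transform, and the homotheties carry it to all the others.\<close>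

lemma irreducible_std_rep: "irreducible_representation G (q - 1) std_rep"
  unfolding irreducible_representation_def
proof (intro conjI allI impI)
  let ?n = "q - 1"
  show "representation G ?n std_rep"
    by (rule representation_std_rep)
  show "?n > 0"
    using q_gt_1 by simp
  fix W
  assume sub: "VectorSpace.subspace class_ring W (module_vec TYPE(complex) ?n)"
    and inv: "\<forall>g\<in>carrier G. \<forall>w\<in>W. std_rep g *\<^sub>v w \<in> W"
  have W: "W \<subseteq> carrier_vec ?n" "0\<^sub>v ?n \<in> W"
    and add: "\<And>v w. \<lbrakk>v \<in> W; w \<in> W\<rbrakk> \<Longrightarrow> v + w \<in> W" and smult: "\<And>c v. v \<in> W \<Longrightarrow> c \<cdot>\<^sub>v v \<in> W"
    using sub unfolding VectorSpace.subspace_def submodule_def by (auto simp: module_vec_def)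
  have std_inv: "std_matrix a b *\<^sub>v w \<in> W" if "\<not> q dvd a" "w \<in> W" for a b w
    using inv t_in_carrier[OF that(1), of b] that by (metis std_rep_t)
  have combination: "vec ?n (\<lambda>i. \<Sum>k<m. c k * f k $ i) \<in> W" if f: "\<And>k. k < m \<Longrightarrow> f k \<in> W" for c f and m :: nat
    using f
  proof (induction m)
    case 0
    have "vec ?n (\<lambda>i. \<Sum>k<0. c k * f k $ i) = 0\<^sub>v ?n"
      by (intro eq_vecI) simp_all
    then show ?case
      using W(2) by metis
  next
    case (Suc m)
    then have "f m \<in> carrier_vec ?n"
      using W(1) by auto
    then have "vec ?n (\<lambda>i. \<Sum>k<Suc m. c k * f k $ i) = vec ?n (\<lambda>i. \<Sum>k<m. c k * f k $ i) + c m \<cdot>\<^sub>v f m"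
      by (intro eq_vecI) auto
    moreover have "vec ?n (\<lambda>i. \<Sum>k<m. c k * f k $ i) + c m \<cdot>\<^sub>v f m \<in> W"
      using Suc by (intro add smult Suc.IH) auto
    ultimately show ?case
      by metis
  qed
  show "W = {0\<^sub>v ?n} \<or> W = carrier_vec ?n"
  proof (cases "W = {0\<^sub>v ?n}")
    case False
    then obtain w where w: "w \<in> W" "w \<noteq> 0\<^sub>v ?n"
      using W(2) by blast
    then have w_carrier: "w \<in> carrier_vec ?n"
      using W(1) by blast
    have "\<exists>k<?n. w $ k \<noteq> 0"
    proof (rule ccontr)
      assume "\<not> ?thesis"
      then have "w = 0\<^sub>v ?n"
        using w_carrier by (intro eq_vecI) auto
      then show False
        using w(2) by blast
    qed
    then obtain k where k: "k < ?n" "w $ k \<noteq> 0"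
      by blast
    \<comment> \<open>Averaging against the inverse of the character number k + 1, with q - (k + 1)
      standing for -(k + 1), annihilates every coordinate except number k.\<close>
    define u where "u = vec ?n (\<lambda>i. \<Sum>b<q. zeta q ^ ((q - (k + 1)) * b) * (std_matrix 1 b *\<^sub>v w) $ i)"
    have "u \<in> W"
      unfolding u_def by (intro combination std_inv not_dvd_1 w(1))
    have "u $ i = (if i = k then of_nat q * w $ k else 0)" if i: "i < ?n" for i
    proof -
      let ?z = "zeta q ^ ((q - (k + 1)) + (i + 1))"
      have "u $ i = (\<Sum>b<q. zeta q ^ ((q - (k + 1)) * b) * (zeta q ^ ((i + 1) * b) * w $ i))"
        using i by (simp add: u_def std_matrix_mult_vec[OF not_dvd_1 w_carrier i] idx_1[OF i] del: One_nat_def)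
      also have "\<dots> = (\<Sum>b<q. ?z ^ b) * w $ i"
        unfolding sum_distrib_right
        by (intro sum.cong refl) (simp add: power_mult[symmetric] power_add[symmetric] algebra_simps)
      also have "(\<Sum>b<q. ?z ^ b) = (if ?z = 1 then of_nat q else 0)"
        by (rule sum_powers_root_of_unity[OF zeta_power_power_self q_pos])
      also have "?z = 1 \<longleftrightarrow> i = k"
      proof -
        have "?z = 1 \<longleftrightarrow> q dvd (q - (k + 1)) + (i + 1)"
          by (rule zeta_power_eq_1_iff)
        also have "\<dots> \<longleftrightarrow> i = k"
        proof
          assume dvd: "q dvd (q - (k + 1)) + (i + 1)"
          have "0 < q - (k + 1) + (i + 1)"
            by simp
          have "(q - (k + 1)) + (i + 1) < 2 * q"
            using i k by auto
          moreover obtain m where m: "(q - (k + 1)) + (i + 1) = q * m"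
            using dvd by (rule dvdE)
          moreover have "m \<noteq> 0"
            using m by (metis \<open>0 < q - (k + 1) + (i + 1)\<close> mult_0_right neq0_conv)
          ultimately have "m = 1"
            by (simp add: m)
          then show "i = k"
            using m k by simp
        qed (use k in simp)
        finally show ?thesis .
      qed
      finally show ?thesis
        by simp
    qed
    then have "(1 / (of_nat q * w $ k)) \<cdot>\<^sub>v u = unit_vec ?n k"
      using k q_pos by (intro eq_vecI) (auto simp: u_def)
    then have unit_k: "unit_vec ?n k \<in> W"
      using smult[OF \<open>u \<in> W\<close>] by metis
    have unit: "unit_vec ?n j \<in> W" if j: "j < ?n" for j
    proof -
      have j_dvd: "\<not> q dvd j + 1" and k_dvd: "\<not> q dvd k + 1"
        using j k by (auto dest: dvd_imp_le)
      obtain j' where j': "\<not> q dvd j'" "[(j + 1) * j' = 1] (mod q)"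
        using inverse_parameters[OF j_dvd] by metis
      \<comment> \<open>Modulo q this is (k + 1) / (j + 1), so that j is the row in which
        \<open>std_matrix a 0\<close> has its nonzero entry in column k.\<close>
      define a where "a = j' * (k + 1)"
      have a: "\<not> q dvd a"
        unfolding a_def using j'(1) k_dvd by (rule not_dvd_mult)
      have "[(j + 1) * a = k + 1] (mod q)"
        using cong_scalar_right[OF j'(2), of "k + 1"] by (simp only: a_def mult.assoc mult_1)
      then have idx_j: "k = idx j a"
        using eq_idx_iff[OF a j k(1)] by simp
      have inj: "i = j" if i: "i < ?n" "idx i a = k" for i
      proof -
        obtain a' where a': "[a * a' = 1] (mod q)"
          using inverse_parameters[OF a] by metis
        have "idx i (a * a') = idx j (a * a')"
          using idx_idx[OF a i(1), of a'] idx_idx[OF a j, of a'] i(2) idx_j by simp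
        moreover have "idx i (a * a') = i" if "i < ?n" for i
          using cong_scalar_left[OF a', of "i + 1"] that by (simp add: idx_def cong_def)
        ultimately show ?thesis
          using i(1) j by metis
      qed
      have "std_matrix a 0 *\<^sub>v unit_vec ?n k = unit_vec ?n j"
      proof (rule eq_vecI)
        fix i assume "i < dim_vec (unit_vec ?n j :: complex vec)"
        then have i: "i < ?n" by simp
        have "(std_matrix a 0 *\<^sub>v unit_vec ?n k) $ i = unit_vec ?n k $ idx i a"
          using std_matrix_mult_vec[OF a unit_vec_carrier i, of 0 k] by simp
        also have "\<dots> = unit_vec ?n j $ i"
          using idx_less[OF a i] i j k(1) inj[OF i] idx_j by auto
        finally show "(std_matrix a 0 *\<^sub>v unit_vec ?n k) $ i = unit_vec ?n j $ i" .
      qed (simp add: std_matrix_def)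
      then show ?thesis
        using std_inv[OF a unit_k] by metis
    qed
    have "v \<in> W" if v: "v \<in> carrier_vec ?n" for v
    proof -
      have "vec ?n (\<lambda>i. \<Sum>j<?n. v $ j * unit_vec ?n j $ i) = v"
      proof (rule eq_vecI)
        fix i assume "i < dim_vec v"
        then have i: "i < ?n"
          using v by simp
        have "(\<Sum>j<?n. v $ j * unit_vec ?n j $ i) = (\<Sum>j<?n. if j = i then v $ j else 0)"
          using i by (intro sum.cong) auto
        also have "\<dots> = v $ i"
          using i by (subst sum.delta) auto
        finally show "vec ?n (\<lambda>i. \<Sum>j<?n. v $ j * unit_vec ?n j $ i) $ i = v $ i"
          using i by simp
      qed (use v in simp)
      moreover have "vec ?n (\<lambda>i. \<Sum>j<?n. v $ j * unit_vec ?n j $ i) \<in> W"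
        by (intro combination unit)
      ultimately show ?thesis
        by metis
    qed
    then show ?thesis
      using W(1) by blast
  qed simp
qed

lemma irreducible_character_values:
  assumes "irreducible_character G \<chi>" "\<chi> \<one> \<noteq> 1" "\<not> q dvd a"
  shows "\<chi> (t a b) = (if [a = 1] (mod q) then if q dvd b then of_nat (q - 1) else - 1 else 0)"
proof -
  obtain n \<rho> where irr: "irreducible_representation G n \<rho>" and \<chi>: "\<chi> = (\<lambda>g\<in>carrier G. mat_trace (\<rho> g))"
    using assms(1) unfolding irreducible_character_def by blast
  have rep: "representation G n \<rho>"
    using irr by (simp add: irreducible_representation_def)
  have \<chi>_t: "\<chi> (t a b) = mat_trace (\<rho> (t a b))" if "\<not> q dvd a" for a b
    using t_in_carrier[OF that] by (simp add: \<chi>)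
  have \<chi>_one: "\<chi> (t 1 0) = of_nat n"
    using rep_one[OF rep] \<chi>_t[OF not_dvd_1, of 0] by (simp add: mat_trace_one)
  \<comment> \<open>The value at the identity is the dimension, so the condition in the description
    of the character excludes exactly dimension 1.\<close>
  then have n: "n \<noteq> 1"
    using assms(2) t_one by auto
  show ?thesis
  proof (cases "[a = 1] (mod q)")
    case True
    then have "t a b = t 1 b"
      using assms(3) by (intro t_cong cong_refl)
    show ?thesis
    proof (cases "q dvd b")
      case True
      then have "t 1 b = t 1 0"
        using not_dvd_1 by (intro t_cong) (simp_all add: cong_0_iff)
      then show ?thesis
        using \<open>t a b = t 1 b\<close> \<open>[a = 1] (mod q)\<close> True \<chi>_one dim_eq[OF irr n] by simp
    next
      case False
      then show ?thesis
        using \<open>t a b = t 1 b\<close> \<open>[a = 1] (mod q)\<close> trace_translation[OF irr n False] \<chi>_t[OF not_dvd_1, of b]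
        by simp
    qed
  next
    case False
    then show ?thesis
      using trace_nontranslation[OF irr n assms(3)] assms(3) by (simp add: \<chi>_t)
  qed
qed

text \<open>The explicit model proves existence, its dimension q - 1 being at least 2. Uniqueness
  follows because the values are forced on the carrier and characters are extensional.\<close>

lemma the_irreducible_character_values:
  assumes "\<not> q dvd a"
  shows "(THE \<chi>. irreducible_character G \<chi> \<and> \<chi> \<one> \<noteq> 1) (t a b) =
    (if [a = 1] (mod q) then if q dvd b then of_nat (q - 1) else - 1 else 0)"
proof -
  let ?P = "\<lambda>\<chi>. irreducible_character G \<chi> \<and> \<chi> \<one> \<noteq> 1"
  define \<chi> where "\<chi> = (\<lambda>g\<in>carrier G. mat_trace (std_rep g))"
  have "\<chi> \<one> = of_nat (q - 1)"
    using t_in_carrier[OF not_dvd_1, of 0]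
    by (simp add: \<chi>_def t_one std_rep_t[OF not_dvd_1] std_matrix_one mat_trace_one del: One_nat_def)
  moreover have "(of_nat (q - 1) :: complex) \<noteq> of_nat 1"
    using q_gt_2 unfolding of_nat_eq_iff by simp
  ultimately have "\<chi> \<one> \<noteq> 1"
    by simp
  then have "?P \<chi>"
    unfolding \<chi>_def irreducible_character_def using irreducible_std_rep by blast
  moreover have "\<psi> = \<chi>" if "?P \<psi>" for \<psi>
  proof -
    have "\<psi> \<in> extensional (carrier G)" "\<chi> \<in> extensional (carrier G)"
      using that \<open>?P \<chi>\<close> unfolding irreducible_character_def by auto
    then show ?thesis
    proof (rule extensionalityI)
      fix g assume "g \<in> carrier G"
      then obtain c d where "g = t c d" "\<not> q dvd c"
        by (auto simp: carrier)
      then show "\<psi> g = \<chi> g"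
        using that \<open>?P \<chi>\<close> irreducible_character_values[of \<psi> c d] irreducible_character_values[of \<chi> c d]
        by simp
    qed
  qed
  ultimately have "?P (THE \<chi>. ?P \<chi>)"
    by (rule theI)
  then show ?thesis
    using irreducible_character_values assms by blast
qed

end

subsection \<open>Frobenius elements\<close>

text \<open>By Lagrange the index of the subgroup generated by 2 times the order of 2 is p - 1 = q
  m, so q divides the index iff the order divides m.\<close>

lemma dvd_index_of_two_iff:
  assumes p: "Factorial_Ring.prime p" "odd p" and m: "p - 1 = q * m"
  shows "q dvd index_of_two p \<longleftrightarrow> [2 ^ m = 1] (mod p)"
proof -
  have "p > 2"
    using p prime_gt_1_nat[of p] by (cases "p = 2") auto
  interpret residues_prime p "residue_ring (int p)"
    by unfold_locales (use p in simp_all)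
  let ?R = "residue_ring (int p)"
  define G where "G = units_of ?R"
  interpret G: group G
    unfolding G_def by (rule units_group)
  have carrier: "carrier G = {1..int p - 1}"
    unfolding G_def units_of_def using res_prime_units_eq \<open>p > 2\<close> by (simp add: of_nat_diff)
  have two: "2 \<in> carrier G"
    unfolding carrier using \<open>p > 2\<close> by simp
  have "Coset.order G = p - 1"
    unfolding Coset.order_def carrier using \<open>p > 2\<close> by simp
  moreover have "subgroup (generate G {2}) G"
    using two by (intro G.generate_is_subgroup) simp
  ultimately have "index_of_two p * card (generate G {2}) = p - 1"
    using G.lagrange unfolding index_of_two_def Let_def G_def by metis
  then have index: "index_of_two p * G.ord 2 = q * m"
    using G.generate_pow_card[OF two] m by simp
  have "finite (carrier G)"
    unfolding carrier by simp
  then have "G.ord 2 > 0"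
    using G.ord_ge_1[OF _ two] by simp
  have "q * m > 0"
    unfolding m[symmetric] using \<open>p > 2\<close> by simp
  have "q dvd index_of_two p \<longleftrightarrow> G.ord 2 dvd m"
  proof
    assume "q dvd index_of_two p"
    then obtain k where k: "index_of_two p = q * k"
      by (rule dvdE)
    have "q * (k * G.ord 2) = q * m"
      using index unfolding k mult.assoc .
    then have "k * G.ord 2 = m"
      using \<open>q * m > 0\<close> by (metis nat_mult_eq_cancel1 nat_0_less_mult_iff)
    then show "G.ord 2 dvd m"
      by (metis dvd_triv_right)
  next
    assume "G.ord 2 dvd m"
    then obtain k where k: "m = G.ord 2 * k"
      by (rule dvdE)
    have "G.ord 2 * index_of_two p = G.ord 2 * (q * k)"
      using index unfolding k by (simp only: ac_simps)
    then have "index_of_two p = q * k"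
      using \<open>G.ord 2 > 0\<close> by (metis nat_mult_eq_cancel1)
    then show "q dvd index_of_two p"
      by simp
  qed
  also have "\<dots> \<longleftrightarrow> 2 [^]\<^bsub>G\<^esub> m = \<one>\<^bsub>G\<^esub>"
    using G.pow_eq_id[OF two] by simp
  also have "2 [^]\<^bsub>G\<^esub> m = 2 ^ m mod int p"
  proof -
    have "2 \<in> Units ?R"
      using two unfolding G_def units_of_def by simp
    then have "2 [^]\<^bsub>G\<^esub> m = 2 [^]\<^bsub>?R\<^esub> m"
      unfolding G_def by (rule units_of_pow)
    also have "\<dots> = (2 mod int p) [^]\<^bsub>?R\<^esub> m"
      using \<open>p > 2\<close> by simp
    also have "\<dots> = 2 ^ m mod int p"
      by (rule pow_cong)
    finally show ?thesis .
  qed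
  also have "\<one>\<^bsub>G\<^esub> = 1"
    unfolding G_def units_of_def using res_one_eq by simp
  also have "2 ^ m mod int p = 1 \<longleftrightarrow> [2 ^ m = 1] (mod p)"
  proof -
    have "2 ^ m mod int p = int (2 ^ m mod p)"
      by (simp add: zmod_int)
    also have "\<dots> = 1 \<longleftrightarrow> 2 ^ m mod p = 1"
      by linarith
    finally show ?thesis
      using \<open>p > 2\<close> by (simp add: cong_def)
  qed
  finally show ?thesis .
qed

section \<open>Reduction modulo a prime ideal above p\<close>

context odd_prime
begin

context
  fixes p :: nat and P
  assumes p: "Factorial_Ring.prime p" "odd p" "p \<noteq> q"
    and P: "primeideal P (ring_on (int_ring_of (radical_field q)))" "of_nat p \<in> P"
begin

interpretation P: primeideal P "ring_on (int_ring_of (radical_field q))"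
  by (rule P)

lemma integers_mult:
  "\<lbrakk>x \<in> int_ring_of (radical_field q); y \<in> int_ring_of (radical_field q)\<rbrakk> \<Longrightarrow>
    x * y \<in> int_ring_of (radical_field q)"
  using P.m_closed by simp

lemma of_int_integer: "of_int k \<in> int_ring_of (radical_field q)"
  by (simp add: int_ring_of_def L.of_int)

lemma integers_power:
  "x \<in> int_ring_of (radical_field q) \<Longrightarrow> x ^ k \<in> int_ring_of (radical_field q)"
  using of_int_integer[of 1] by (induction k) (simp_all add: integers_mult)

lemma integers_add:
  "\<lbrakk>x \<in> int_ring_of (radical_field q); y \<in> int_ring_of (radical_field q)\<rbrakk> \<Longrightarrow>
    x + y \<in> int_ring_of (radical_field q)"
  using P.a_closed by simp

lemma integers_diff:
  "\<lbrakk>x \<in> int_ring_of (radical_field q); y \<in> int_ring_of (radical_field q)\<rbrakk> \<Longrightarrow>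
    x - y \<in> int_ring_of (radical_field q)"
  using integers_add[of x "- y"] by (simp add: int_ring_of_def L.minus)

lemma zeta_integer: "zeta q \<in> int_ring_of (radical_field q)"
  using algebraic_int_of_power[of "zeta q" q 1] q_pos
  by (simp add: int_ring_of_def zeta_in_L zeta_power_self)

lemma radical_integer: "radical q \<in> int_ring_of (radical_field q)"
  using algebraic_int_of_power[of "radical q" q 2] q_pos radical_power
  by (simp add: int_ring_of_def radical_in_L)

lemma P_add: "\<lbrakk>x \<in> P; y \<in> P\<rbrakk> \<Longrightarrow> x + y \<in> P"
  using additive_subgroup.a_closed[OF P.additive_subgroup_axioms, of x y] by simp

lemma P_mult: "\<lbrakk>x \<in> P; y \<in> int_ring_of (radical_field q)\<rbrakk> \<Longrightarrow> y * x \<in> P"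
  using P.I_l_closed by simp

lemma P_minus: "x \<in> P \<Longrightarrow> - x \<in> P"
  using P_mult[of x "-1"] of_int_integer[of "-1"] by simp

lemma P_0: "0 \<in> P"
  using P_mult[OF P(2) of_int_integer[of 0]] by simp

lemma P_sum: "(\<And>i. i \<in> A \<Longrightarrow> h i \<in> P) \<Longrightarrow> sum h A \<in> P"
  by (induction A rule: infinite_finite_induct) (auto intro: P_0 P_add)

lemma one_notin_P: "1 \<notin> P"
proof
  assume "1 \<in> P"
  then have "x \<in> P" if "x \<in> int_ring_of (radical_field q)" for x
    using P_mult[OF \<open>1 \<in> P\<close> that] by simp
  moreover have "P \<subseteq> int_ring_of (radical_field q)"
    using P.a_subset by simp
  ultimately show False
    using P.I_notcarr by auto
qed

lemma P_prime:
  "\<lbrakk>x \<in> int_ring_of (radical_field q); y \<in> int_ring_of (radical_field q); x * y \<in> P\<rbrakk> \<Longrightarrow>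
    x \<in> P \<or> y \<in> P"
  using P.I_prime by simp

text \<open>P meets the integers in the multiples of p: an integer in P coprime to p would put 1
  into P by Bezout.\<close>

lemma of_int_in_P_iff: "of_int k \<in> P \<longleftrightarrow> int p dvd k"
proof
  assume "int p dvd k"
  then obtain l where "k = int p * l"
    by (rule dvdE)
  then show "of_int k \<in> P"
    using P_mult[OF P(2) of_int_integer[of l]] by (simp add: mult.commute)
next
  assume k: "of_int k \<in> P"
  show "int p dvd k"
  proof (rule ccontr)
    assume "\<not> int p dvd k"
    then have "gcd (int p) k = 1"
      using p(1) by (simp add: Factorial_Ring.prime_imp_coprime flip: coprime_iff_gcd_eq_1)
    then obtain u v where "u * int p + v * k = 1"
      using bezout_int[of "int p" k] by auto
    then have "of_int u * of_nat p + of_int v * of_int k = (1 :: complex)"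
      by (metis of_int_1 of_int_add of_int_mult of_int_of_nat_eq)
    moreover have "of_int u * of_nat p + of_int v * of_int k \<in> P"
      using k P(2) by (intro P_add P_mult of_int_integer)
    ultimately show False
      using one_notin_P by simp
  qed
qed

text \<open>The sum of \<open>\<zeta>\<^sup>k\<^sup>j - 1\<close> over \<open>j\<close> is \<open>-q\<close> for nontrivial \<open>\<zeta>\<^sup>k\<close>, and \<open>q\<close> does not lie in \<open>P\<close>.\<close>

lemma zeta_power_cong_1:
  assumes "zeta q ^ k - 1 \<in> P"
  shows "q dvd k"
proof (rule ccontr)
  assume "\<not> q dvd k"
  let ?z = "zeta q ^ k"
  have z: "?z ^ q = 1" "?z \<noteq> 1"
    using \<open>\<not> q dvd k\<close> by (simp_all add: zeta_power_power_self zeta_power_eq_1_iff)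
  have "?z ^ j - 1 \<in> P" for j
  proof (induction j)
    case (Suc j)
    have eq: "?z ^ Suc j - 1 = ?z * (?z ^ j - 1) + (?z - 1)"
      by (simp add: algebra_simps)
    show ?case
      unfolding eq by (rule P_add[OF P_mult[OF Suc.IH integers_power[OF zeta_integer, of k]] assms])
  qed (simp add: P_0)
  then have "(\<Sum>j<q. ?z ^ j - 1) \<in> P"
    by (rule P_sum)
  also have "(\<Sum>j<q. ?z ^ j - 1) = of_int (- int q)"
    using sum_powers_root_of_unity[OF z(1) q_pos] z(2) by (simp add: sum_subtractf)
  finally have "p dvd q"
    unfolding of_int_in_P_iff by simp
  then show False
    using p prime primes_dvd_imp_eq by blast
qed

text \<open>Multiplication by the power with exponent (q - 1) b, which is the inverse of the power
  with exponent b, reduces this to a congruence with 1.\<close>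

lemma zeta_power_cong:
  assumes "zeta q ^ a - zeta q ^ b \<in> P"
  shows "[a = b] (mod q)"
proof -
  have "zeta q ^ ((q - 1) * b) * (zeta q ^ a - zeta q ^ b) \<in> P"
    by (rule P_mult[OF assms integers_power[OF zeta_integer]])
  also have "zeta q ^ ((q - 1) * b) * (zeta q ^ a - zeta q ^ b) = zeta q ^ ((q - 1) * b + a) - zeta q ^ ((q - 1) * b + b)"
    by (simp only: right_diff_distrib power_add)
  also have q1: "(q - 1) * b + b = q * b"
    using q_pos by (cases q) simp_all
  also have "zeta q ^ (q * b) = 1"
    by (simp add: zeta_power_eq_1_iff)
  finally have "q dvd (q - 1) * b + a"
    by (rule zeta_power_cong_1)
  then have "[(q - 1) * b + a = (q - 1) * b + b] (mod q)"
    unfolding q1 by (simp add: cong_def dvd_eq_mod_eq_0)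
  then show ?thesis
    by (simp only: cong_add_lcancel_nat)
qed

lemma frobenius_power_residue:
  assumes frob: "zeta q ^ b * radical q - radical q ^ p \<in> P" and m: "p - 1 = q * m"
  shows "q dvd b \<longleftrightarrow> [2 ^ m = 1] (mod p)"
proof -
  have "p > 2"
    using p prime_gt_1_nat[of p] by (cases "p = 2") auto
  \<comment> \<open>This permits cancelling the radical below: were it in P, so would be 2, and then
    the odd prime p would divide 2.\<close>
  have "radical q \<notin> P"
  proof
    assume "radical q \<in> P"
    then have "radical q ^ (q - 1) * radical q \<in> P"
      by (rule P_mult[OF _ integers_power[OF radical_integer]])
    also have "radical q ^ (q - 1) * radical q = radical q ^ q"
      using q_pos by (cases q) simp_all
    finally have "of_int 2 \<in> P"
      by (simp add: radical_power)
    then have "int p dvd 2"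
      unfolding of_int_in_P_iff .
    then show False
      using \<open>p > 2\<close> by (auto dest: zdvd_imp_le)
  qed
  \<comment> \<open>With p = q m + 1 the p-th power of the radical is the radical times 2^m, so
    after cancellation the root of unity is congruent to 2^m.\<close>
  have "p = Suc (q * m)"
    using m \<open>p > 2\<close> by simp
  then have "radical q ^ p = radical q * 2 ^ m"
    by (simp add: power_mult radical_power)
  then have "radical q * (zeta q ^ b - of_int (2 ^ m)) \<in> P"
    using frob by (simp add: algebra_simps)
  then have key: "zeta q ^ b - of_int (2 ^ m) \<in> P"
    using P_prime[OF radical_integer] \<open>radical q \<notin> P\<close> integers_diff[OF integers_power[OF zeta_integer] of_int_integer]
    by blast
  have "q dvd b \<longleftrightarrow> of_int (2 ^ m - 1) \<in> P"
  proof
    assume "q dvd b"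
    then have "zeta q ^ b = 1"
      by (simp add: zeta_power_eq_1_iff)
    then show "of_int (2 ^ m - 1) \<in> P"
      using P_minus[OF key] by simp
  next
    assume "of_int (2 ^ m - 1) \<in> P"
    then have "(zeta q ^ b - of_int (2 ^ m)) + of_int (2 ^ m - 1) \<in> P"
      using key by (intro P_add)
    then have "zeta q ^ b - 1 \<in> P"
      by simp
    then show "q dvd b"
      by (rule zeta_power_cong_1)
  qed
  also have "\<dots> \<longleftrightarrow> [2 ^ m = 1] (mod int p)"
    unfolding of_int_in_P_iff by (simp add: cong_iff_dvd_diff)
  also have "\<dots> \<longleftrightarrow> [int (2 ^ m) = int 1] (mod int p)"
    by simp
  also have "\<dots> \<longleftrightarrow> [2 ^ m = 1] (mod p)"
    by (rule cong_int_iff)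
  finally show ?thesis .
qed

end

lemma sum_e2pi_multiples:
  "(\<Sum>c\<in>{1..<q}. e2pi (real k * real c / real q)) = (if q dvd k then of_nat (q - 1) else - 1)"
proof -
  let ?z = "zeta q ^ k"
  have "e2pi (real k * real c / real q) = ?z ^ c" for c
  proof -
    have "?z ^ c = zeta q ^ (k * c)"
      by (simp only: power_mult)
    then show ?thesis
      by (simp only: zeta_power of_nat_mult)
  qed
  then have "(\<Sum>c\<in>{1..<q}. e2pi (real k * real c / real q)) = (\<Sum>c\<in>{1..<q}. ?z ^ c)"
    by (simp only:)
  also have "\<dots> = (\<Sum>c<q. ?z ^ c) - 1"
    using q_pos by (simp add: lessThan_atLeast0 sum.atLeast_Suc_lessThan)
  also have "(\<Sum>c<q. ?z ^ c) = (if ?z = 1 then of_nat q else 0)"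
    by (rule sum_powers_root_of_unity[OF zeta_power_power_self q_pos])
  also have "?z = 1 \<longleftrightarrow> q dvd k"
    by (rule zeta_power_eq_1_iff)
  finally show ?thesis
    using q_pos by (simp add: of_nat_diff split: if_splits)
qed

lemma affine_group_Ggroup: "affine_group q (Ggroup q) aut"
  by unfold_locales (auto simp: carrier_Ggroup aut_eq_iff mult_Ggroup one_Ggroup)

lemma phi_aut:
  assumes "\<not> q dvd a"
  shows "phi q (aut a b) = (if [a = 1] (mod q) then if q dvd b then of_nat (q - 1) else - 1 else 0)"
  unfolding phi_def by (rule affine_group.the_irreducible_character_values[OF affine_group_Ggroup assms])

lemma phi_frobenius:
  assumes p: "Factorial_Ring.prime p" "odd p" "p \<noteq> q" and frob: "frobenius_element (Lfield q) p s"
  shows "phi q s =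
    (if [p = 1] (mod q) then \<Sum>c\<in>{1..<q}. e2pi (real (index_of_two p) * real c / real q) else 0)"
proof -
  obtain P where P: "primeideal P (ring_on (int_ring_of (radical_field q)))" "of_nat p \<in> P"
    and cong: "\<forall>x\<in>int_ring_of (radical_field q). s x - x ^ p \<in> P" and "s \<in> carrier (Ggroup q)"
    using frob unfolding frobenius_element_def Lfield_eq Ggroup_def by blast
  then obtain a b where s: "s = aut a b" and a: "\<not> q dvd a"
    by (auto simp: carrier_Ggroup)
  \<comment> \<open>The Frobenius congruence at the root of unity determines the slope a modulo q;
    at the radical it will decide whether q divides b.\<close>
  have "zeta q ^ a - zeta q ^ p \<in> P"
    using cong zeta_integer[OF p P] aut_zeta[OF a, of b] s by metis
  then have "[a = p] (mod q)"
    by (rule zeta_power_cong[OF p P])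
  then have a1: "[a = 1] (mod q) \<longleftrightarrow> [p = 1] (mod q)"
    by (simp add: cong_def)
  show ?thesis
  proof (cases "[p = 1] (mod q)")
    case True
    define m where "m = (p - 1) div q"
    have "p > 0"
      using p(1) by (rule prime_gt_0_nat)
    then have "q dvd p - 1"
      using True by (metis One_nat_def Suc_leI cong_altdef_nat)
    then have m: "p - 1 = q * m"
      by (simp add: m_def)
    have "zeta q ^ b * radical q - radical q ^ p \<in> P"
      using cong radical_integer[OF p P] aut_radical[OF a, of b] s by metis
    then have "q dvd b \<longleftrightarrow> [2 ^ m = 1] (mod p)"
      by (rule frobenius_power_residue[OF p P _ m])
    then have "q dvd b \<longleftrightarrow> q dvd index_of_two p"
      using dvd_index_of_two_iff[OF p(1,2) m] by simp
    then show ?thesis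
      using True a1 by (simp only: s phi_aut[OF a] sum_e2pi_multiples if_True)
  next
    case False
    then show ?thesis
      using a1 by (simp add: s phi_aut[OF a])
  qed
qed

end

subsection \<open>The inequality\<close>

lemma finite_odd_primes_upto: "finite (odd_primes_upto y)"
proof (rule finite_subset)
  show "odd_primes_upto y \<subseteq> {..nat \<lfloor>y\<rfloor>}"
    by (auto simp: odd_primes_upto_def le_nat_floor)
qed simp

theorem lemma13:
  fixes Q x :: real
    and \<sigma> :: "nat \<Rightarrow> nat \<Rightarrow> complex \<Rightarrow> complex"
  assumes "Q \<ge> 1" and "x \<ge> 1"
    and "\<And>q p. \<lbrakk>Factorial_Ring.prime q; odd q; Factorial_Ring.prime p; odd p; p \<noteq> q\<rbrakk> \<Longrightarrow> frobenius_element (Lfield q) p (\<sigma> q p)"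
  shows "(\<Sum>q\<in>odd_primes_upto Q. (cmod (\<Sum>p\<in>odd_primes_upto x. phi_frob \<sigma> q p))\<^sup>2)
       \<le> Q * (\<Sum>q\<in>odd_primes_upto Q. \<Sum>c\<in>{1..<q}.
            (cmod (\<Sum>p\<in>{p\<in>odd_primes_upto x. [p = 1] (mod q)}.
                     e2pi (real (index_of_two p) * real c / real q)))\<^sup>2)"
proof (subst sum_distrib_left, rule sum_mono)
  fix q assume q: "q \<in> odd_primes_upto Q"
  interpret odd_prime q
    using q by unfold_locales (auto simp: odd_primes_upto_def)
  let ?X = "{p \<in> odd_primes_upto x. [p = 1] (mod q)}"
  define e where "e p c = e2pi (real (index_of_two p) * real c / real q)" for p c
  have phi_value: "phi_frob \<sigma> q p = (if [p = 1] (mod q) then \<Sum>c\<in>{1..<q}. e p c else 0)"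
    if "p \<in> odd_primes_upto x" for p
  proof (cases "p = q")
    case True
    \<comment> \<open>For p = q the conventional value 0 agrees with the general formula, because q
      is not congruent to 1 modulo q.\<close>
    then have "\<not> [p = 1] (mod q)"
      using q_gt_1 by (simp add: cong_def)
    then show ?thesis
      using True by (simp add: phi_frob_def)
  next
    case False
    have p: "Factorial_Ring.prime p" "odd p"
      using that by (simp_all add: odd_primes_upto_def)
    show ?thesis
      using phi_frobenius[OF p False assms(3)[OF prime odd p False]] False
      by (simp add: phi_frob_def e_def)
  qed
  have "(\<Sum>p\<in>odd_primes_upto x. phi_frob \<sigma> q p) = (\<Sum>p\<in>?X. \<Sum>c\<in>{1..<q}. e p c)"
    by (simp add: phi_value sum.inter_filter[OF finite_odd_primes_upto] del: One_nat_def)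
  also have "\<dots> = (\<Sum>c\<in>{1..<q}. \<Sum>p\<in>?X. e p c)"
    by (rule sum.swap)
  finally have "cmod (\<Sum>p\<in>odd_primes_upto x. phi_frob \<sigma> q p) \<le> (\<Sum>c\<in>{1..<q}. cmod (\<Sum>p\<in>?X. e p c))"
    by (simp add: sum_norm_le)
  then have "(cmod (\<Sum>p\<in>odd_primes_upto x. phi_frob \<sigma> q p))\<^sup>2 \<le> (\<Sum>c\<in>{1..<q}. cmod (\<Sum>p\<in>?X. e p c))\<^sup>2"
    by (intro power_mono) simp_all
  also have "\<dots> \<le> (\<Sum>c\<in>{1..<q}. (cmod (\<Sum>p\<in>?X. e p c))\<^sup>2) * real (card {1..<q})"
    by (rule sum_squared_le_sum_of_squares)
  \<comment> \<open>The number of residues c is q - 1, which is at most Q.\<close>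
  also have "\<dots> \<le> (\<Sum>c\<in>{1..<q}. (cmod (\<Sum>p\<in>?X. e p c))\<^sup>2) * Q"
    using q by (intro mult_left_mono sum_nonneg) (auto simp: odd_primes_upto_def)
  finally show "(cmod (\<Sum>p\<in>odd_primes_upto x. phi_frob \<sigma> q p))\<^sup>2 \<le>
      Q * (\<Sum>c\<in>{1..<q}. (cmod (\<Sum>p\<in>?X. e2pi (real (index_of_two p) * real c / real q)))\<^sup>2)"
    by (simp add: e_def mult.commute)
qed

end
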